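(* Let $G$ be a countable group and let $\theta:G\to\Pi_{k\to\omega}Sym(n_k)$ be a sofic representation, i.e. a group homomorphism with $\ell_H(\theta(g))=1$ for every $g\in G$, $g\neq e$. Then there exists $p\in\Pi_{k\to\omega}Sym(n_k)$ such that $p\,\theta(g)\,p^{-1}\in\mathcal{GA}$ for every $g\in G$.
   Context: Fix a non-principal ultrafilter $\omega$ on $\mathbb{N}$ and a (strictly) increasing sequence $(n_k)_k$ of natural numbers. Universal sofic group: for $p\in Sym(n)$ the normalised Hamming length is $\ell_H(p)=\frac1n Card\{i:p(i)\neq i\}$. The universal sofic group $\Pi_{k\to\omega}Sym(n_k)$ is the quotient of $\prod_k Sym(n_k)$ by the normal subgroup $\{(p_k)_k:\lim_{k\to\omega}\ell_H(p_k)=0\}$; the class of $(p_k)_k$ is written $\Pi_{k\to\omega}p_k$, and $\ell_H(\Pi_{k\to\omega}p_k)=\lim_{k\to\omega}\ell_H(p_k)$. Loeb space: $X_\omega=\prod_k\{1,\ldots,n_k\}/\sim$, where $(x_k)_k\sim(y_k)_k$ iff $\{k:x_k=y_k\}\in\omega$; the class of $(x_k)_k$ is still written $(x_k)_k$. For $A_k\subset\{1,\ldots,n_k\}$ put $\Pi_{k\to\omega}A_k=\{(x_k)_k\in X_\omega:\{k:x_k\in A_k\}\in\omega\}$ and $\mu_\omega(\Pi_{k\to\omega}A_k)=\lim_{k\to\omega}Card(A_k)/n_k$. These sets form an algebra on which $\mu_\omega$ is a pre-measure; $(X_\omega,\mathcal{B}_\omega,\mu_\omega)$ is the completion of its Carathéodory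 extension to the generated $\sigma$-algebra. Action: $p=\Pi_{k\to\omega}p_k$ acts on $X_\omega$ by $p((x_k)_k)=(p_k(x_k))_k$; this is a measure-preserving automorphism of $(X_\omega,\mu_\omega)$, well defined up to a $\mu_\omega$-null set. Standard part: $X=[0,1]$ with Lebesgue measure $\mu$, and $St:X_\omega\to X$, $St((x_k)_k)=\lim_{k\to\omega}\frac{x_k}{n_k}$ (it is measure preserving). $p|_X$ and $\mathcal{GA}$: for $p\in\Pi_{k\to\omega}Sym(n_k)$ we say $p|_X$ exists, and write $p|_X=\varphi$, if there is $\varphi:X\to X$ with $St(p(x))=\varphi(St(x))$ for $\mu_\omega$-almost all $x\in X_\omega$ ($\varphi$ is then determined $\mu$-almost everywhere). $\mathcal{GA}$ is the set of $p\in\Pi_{k\to\omega}Sym(n_k)$ such that $p|_X$ exists and is an automorphism of $(X,\mu)$, i.e. a measure-preserving map invertible modulo null sets. *)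

theory Defs
  imports "HOL-Analysis.Analysis" "HOL-Algebra.Sym_Groups" "HOL-Algebra.Product_Groups"
begin

definition nonprincipal_ultrafilter :: "'a filter \<Rightarrow> bool" where
  "nonprincipal_ultrafilter \<omega> \<longleftrightarrow>
     \<omega> \<noteq> bot \<and>
     (\<forall>P. eventually P \<omega> \<or> eventually (\<lambda>k. \<not> P k) \<omega>) \<and>
     (\<forall>a. \<omega> \<noteq> principal {a})"

section \<open>The universal sofic group\<close>

definition hamming_length :: "nat \<Rightarrow> (nat \<Rightarrow> nat) \<Rightarrow> real" where
  "hamming_length m p = real (card {i \<in> {1..m}. p i \<noteq> i}) / real m"

definition sym_product :: "(nat \<Rightarrow> nat) \<Rightarrow> (nat \<Rightarrow> nat \<Rightarrow> nat) monoid" where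
  "sym_product n = product_group UNIV (\<lambda>k. sym_group (n k))"

definition hamming_null :: "nat filter \<Rightarrow> (nat \<Rightarrow> nat) \<Rightarrow> (nat \<Rightarrow> nat \<Rightarrow> nat) set" where
  "hamming_null \<omega> n =
     {p \<in> carrier (sym_product n). ((\<lambda>k. hamming_length (n k) (p k)) \<longlongrightarrow> 0) \<omega>}"

definition universal_sofic ::
    "nat filter \<Rightarrow> (nat \<Rightarrow> nat) \<Rightarrow> (nat \<Rightarrow> nat \<Rightarrow> nat) set monoid" where
  "universal_sofic \<omega> n = sym_product n Mod hamming_null \<omega> n"

(* An element of the quotient is a coset, i.e. the set of all sequences representing it;
   the limit does not depend on the representative. *)
definition sofic_length ::
    "nat filter \<Rightarrow> (nat \<Rightarrow> nat) \<Rightarrow> (nat \<Rightarrow> nat \<Rightarrow> nat) set \<Rightarrow> real" where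
  "sofic_length \<omega> n p =
     (THE l. \<forall>q\<in>p. ((\<lambda>k. hamming_length (n k) (q k)) \<longlongrightarrow> l) \<omega>)"

definition sofic_representation ::
    "nat filter \<Rightarrow> (nat \<Rightarrow> nat) \<Rightarrow> ('g, 'b) monoid_scheme
      \<Rightarrow> ('g \<Rightarrow> (nat \<Rightarrow> nat \<Rightarrow> nat) set) \<Rightarrow> bool" where
  "sofic_representation \<omega> n G \<theta> \<longleftrightarrow>
     \<theta> \<in> hom G (universal_sofic \<omega> n) \<and>
     (\<forall>g \<in> carrier G. g \<noteq> \<one>\<^bsub>G\<^esub> \<longrightarrow> sofic_length \<omega> n (\<theta> g) = 1)"

section \<open>The Loeb space\<close>

definition loeb_seqs :: "(nat \<Rightarrow> nat) \<Rightarrow> (nat \<Rightarrow> nat) set" where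
  "loeb_seqs n = (\<Pi>\<^sub>E k\<in>UNIV. {1..n k})"

definition loeb_rel :: "nat filter \<Rightarrow> (nat \<Rightarrow> nat) \<Rightarrow> ((nat \<Rightarrow> nat) \<times> (nat \<Rightarrow> nat)) set" where
  "loeb_rel \<omega> n =
     {(x, y). x \<in> loeb_seqs n \<and> y \<in> loeb_seqs n \<and> (\<forall>\<^sub>F k in \<omega>. x k = y k)}"

definition loeb_space :: "nat filter \<Rightarrow> (nat \<Rightarrow> nat) \<Rightarrow> (nat \<Rightarrow> nat) set set" where
  "loeb_space \<omega> n = loeb_seqs n // loeb_rel \<omega> n"

definition loeb_class :: "nat filter \<Rightarrow> (nat \<Rightarrow> nat) \<Rightarrow> (nat \<Rightarrow> nat) \<Rightarrow> (nat \<Rightarrow> nat) set" where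
  "loeb_class \<omega> n x = loeb_rel \<omega> n `` {x}"

definition internal_set ::
    "nat filter \<Rightarrow> (nat \<Rightarrow> nat) \<Rightarrow> (nat \<Rightarrow> nat set) \<Rightarrow> (nat \<Rightarrow> nat) set set" where
  "internal_set \<omega> n A = loeb_class \<omega> n ` {x \<in> loeb_seqs n. \<forall>\<^sub>F k in \<omega>. x k \<in> A k}"

definition internal_sets :: "nat filter \<Rightarrow> (nat \<Rightarrow> nat) \<Rightarrow> (nat \<Rightarrow> nat) set set set" where
  "internal_sets \<omega> n = internal_set \<omega> n ` {A. \<forall>k. A k \<subseteq> {1..n k}}"

definition loeb_premeasure ::
    "nat filter \<Rightarrow> (nat \<Rightarrow> nat) \<Rightarrow> (nat \<Rightarrow> nat) set set \<Rightarrow> ennreal" where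
  "loeb_premeasure \<omega> n E =
     ennreal (THE m. \<exists>A. (\<forall>k. A k \<subseteq> {1..n k}) \<and> E = internal_set \<omega> n A \<and>
       ((\<lambda>k. real (card (A k)) / real (n k)) \<longlongrightarrow> m) \<omega>)"

(* The Caratheodory extension is the restriction of the outer measure induced by the
   pre-measure to the sigma-algebra generated by the internal sets. *)
definition loeb_measure :: "nat filter \<Rightarrow> (nat \<Rightarrow> nat) \<Rightarrow> (nat \<Rightarrow> nat) set measure" where
  "loeb_measure \<omega> n =
     completion (measure_of (loeb_space \<omega> n) (internal_sets \<omega> n)
       (outer_measure (internal_sets \<omega> n) (loeb_premeasure \<omega> n)))"

(* All classes in the union coincide. *)
definition loeb_action ::
    "nat filter \<Rightarrow> (nat \<Rightarrow> nat) \<Rightarrow> (nat \<Rightarrow> nat \<Rightarrow> nat) \<Rightarrow> (nat \<Rightarrow> nat) set \<Rightarrow> (nat \<Rightarrow> nat) set" where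
  "loeb_action \<omega> n q x = (\<Union>y\<in>x. loeb_class \<omega> n (\<lambda>k. q k (y k)))"

section \<open>Standard part and the set GA\<close>

definition standard_part :: "nat filter \<Rightarrow> (nat \<Rightarrow> nat) \<Rightarrow> (nat \<Rightarrow> nat) set \<Rightarrow> real" where
  "standard_part \<omega> n x = (THE l. \<forall>y\<in>x. ((\<lambda>k. real (y k) / real (n k)) \<longlongrightarrow> l) \<omega>)"

definition measure_preserving :: "'a measure \<Rightarrow> ('a \<Rightarrow> 'a) \<Rightarrow> bool" where
  "measure_preserving M f \<longleftrightarrow>
     f \<in> M \<rightarrow>\<^sub>M M \<and> (\<forall>A \<in> sets M. emeasure M (f -` A \<inter> space M) = emeasure M A)"

definition measure_automorphism :: "'a measure \<Rightarrow> ('a \<Rightarrow> 'a) \<Rightarrow> bool" where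
  "measure_automorphism M f \<longleftrightarrow>
     measure_preserving M f \<and>
     (\<exists>g. measure_preserving M g \<and> (AE x in M. g (f x) = x) \<and> (AE x in M. f (g x) = x))"

(* "p|X exists and equals \<phi>".  Representatives q of p act equally almost everywhere, so
   requiring the identity for one of them or for all of them is the same. *)
definition restricts_to ::
    "nat filter \<Rightarrow> (nat \<Rightarrow> nat) \<Rightarrow> (nat \<Rightarrow> nat \<Rightarrow> nat) set \<Rightarrow> (real \<Rightarrow> real) \<Rightarrow> bool" where
  "restricts_to \<omega> n p \<phi> \<longleftrightarrow>
     \<phi> \<in> {0..1} \<rightarrow> {0..1} \<and>
     (\<forall>q\<in>p. AE x in loeb_measure \<omega> n.
        standard_part \<omega> n (loeb_action \<omega> n q x) = \<phi> (standard_part \<omega> n x))"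

definition GA :: "nat filter \<Rightarrow> (nat \<Rightarrow> nat) \<Rightarrow> (nat \<Rightarrow> nat \<Rightarrow> nat) set set" where
  "GA \<omega> n =
     {p \<in> carrier (universal_sofic \<omega> n).
        \<exists>\<phi>. restricts_to \<omega> n p \<phi> \<and> measure_automorphism (lebesgue_on {0..1}) \<phi>}"

end

theory Submission
  imports Defs
begin

text \<open>
  The orbit map \<open>x \<mapsto> (St (\<theta>(h) x))\<^sub>h\<close> is a factor map of the action of \<open>G\<close> on the
  Loeb space, and it only sees the countably many internal sets
  \<open>A(h,a,b) = {x. \<theta>(h) x \<le> (a / b) n}\<close>, which \<open>\<theta>(g)\<close> permutes up to null sets.
  Sort \<open>{1..n\<^sub>k}\<close> lexicographically by the first \<open>k\<close> of the bits \<open>i \<in> A(h,a,b)\<close>, and let \<open>p\<^sub>k\<close> be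
  this sorting permutation.
  Then every cylinder of the bit sequence is mapped by \<open>p\<close> onto an interval, the lengths of these
  intervals tend to \<open>0\<close>, and so \<open>St (p x)\<close> and the bit sequence of \<open>x\<close> determine each other almost
  everywhere. Hence \<open>p \<theta>(g) p\<inverse>\<close> acts on \<open>[0,1]\<close> as \<open>dec \<circ> (shift of the bits by g) \<circ> digits\<close>.
  The law of the bit sequence is shift invariant because its finite-dimensional distributions are
  limits of normalised counts, which the permutations \<open>\<theta>(g)\<^sub>k\<close> asymptotically preserve.
\<close>

section \<open>Ultralimits and null sets of the Loeb measure\<close>

locale ultra =
  fixes \<omega> :: "nat filter"
  assumes ultra: "nonprincipal_ultrafilter \<omega>"
begin

lemma not_bot [simp]: "\<omega> \<noteq> bot"
  using ultra by (simp add: nonprincipal_ultrafilter_def)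

lemma not_eventually_iff: "\<not> eventually P \<omega> \<longleftrightarrow> eventually (\<lambda>k. \<not> P k) \<omega>"
proof
  assume "eventually (\<lambda>k. \<not> P k) \<omega>"
  then show "\<not> eventually P \<omega>"
    using eventually_conj[of P \<omega> "\<lambda>k. \<not> P k"] by auto
qed (use ultra in \<open>auto simp: nonprincipal_ultrafilter_def\<close>)

text \<open>An ultrafilter containing the singleton \<open>{K}\<close> would be
  \<open>principal {K}\<close>. Non-principality therefore removes one point at a time, and with it
  every finite initial segment.\<close>

lemma eventually_ge: "\<forall>\<^sub>F k in \<omega>. K \<le> k"
proof (induction K)
  case (Suc K)
  have "\<omega> = principal {K}" if K: "\<forall>\<^sub>F k in \<omega>. k = K"
  proof (rule antisym)
    show "\<omega> \<le> principal {K}"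
      using K by (simp add: le_principal)
    show "principal {K} \<le> \<omega>"
    proof (rule filter_leI)
      fix P assume "eventually P \<omega>"
      then have "\<exists>k. P k \<and> k = K"
        using K by (metis (mono_tags, lifting) eventually_conj eventually_happens' not_bot)
      then show "eventually P (principal {K})"
        by (simp add: eventually_principal)
    qed
  qed
  then have "\<not> (\<forall>\<^sub>F k in \<omega>. k = K)"
    using ultra by (auto simp: nonprincipal_ultrafilter_def)
  then have "\<forall>\<^sub>F k in \<omega>. k \<noteq> K"
    by (simp add: not_eventually_iff)
  with Suc show ?case
    by eventually_elim auto
qed auto

lemma le_sequentially: "\<omega> \<le> sequentially"
  unfolding at_top_def le_INF_iff by (simp add: le_principal eventually_ge)

text \<open>By compactness the image filter has a cluster point in the interval. For an ultrafilter
  a cluster point is a limit: if \<open>f\<close> were not eventually in a neighbourhood, it would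
  eventually be outside it.\<close>

lemma bounded_convergent:
  fixes f :: "nat \<Rightarrow> real"
  assumes "\<And>k. f k \<in> {a..b}"
  obtains l where "l \<in> {a..b}" "(f \<longlongrightarrow> l) \<omega>"
proof -
  have "\<forall>\<^sub>F y in filtermap f \<omega>. y \<in> {a..b}"
    using assms by (simp add: eventually_filtermap del: atLeastAtMost_iff)
  moreover have "filtermap f \<omega> \<noteq> bot"
    by (simp add: filtermap_bot_iff)
  ultimately obtain l where l: "l \<in> {a..b}" "inf (nhds l) (filtermap f \<omega>) \<noteq> bot"
    using compact_Icc[of a b] unfolding compact_filter le_principal by blast
  have "(f \<longlongrightarrow> l) \<omega>"
  proof (rule topological_tendstoI, rule ccontr)
    fix S assume S: "open S" "l \<in> S" "\<not> (\<forall>\<^sub>F k in \<omega>. f k \<in> S)"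
    then have "eventually (\<lambda>y. y \<in> S) (nhds l)" "eventually (\<lambda>y. y \<notin> S) (filtermap f \<omega>)"
      by (auto simp: eventually_nhds eventually_filtermap not_eventually_iff)
    then have "eventually (\<lambda>_. False) (inf (nhds l) (filtermap f \<omega>))"
      unfolding eventually_inf by blast
    with l show False
      by (simp add: eventually_False)
  qed
  with l that show ?thesis by blast
qed

end

lemma card_near:
  assumes "0 \<le> \<delta>"
  shows "finite {i::nat. \<bar>real i - r\<bar> \<le> \<delta>}"
    "real (card {i::nat. \<bar>real i - r\<bar> \<le> \<delta>}) \<le> 2 * \<delta> + 1"
proof -
  have sub: "{i::nat. \<bar>real i - r\<bar> \<le> \<delta>} \<subseteq> nat ` {\<lceil>r - \<delta>\<rceil>..\<lfloor>r + \<delta>\<rfloor>}"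
  proof
    fix i assume "i \<in> {i::nat. \<bar>real i - r\<bar> \<le> \<delta>}"
    then have "int i \<in> {\<lceil>r - \<delta>\<rceil>..\<lfloor>r + \<delta>\<rfloor>}"
      by (auto simp: ceiling_le_iff le_floor_iff abs_le_iff)
    then show "i \<in> nat ` {\<lceil>r - \<delta>\<rceil>..\<lfloor>r + \<delta>\<rfloor>}"
      by (metis image_eqI nat_int)
  qed
  then show "finite {i::nat. \<bar>real i - r\<bar> \<le> \<delta>}"
    by (rule finite_subset) simp
  from sub have "card {i::nat. \<bar>real i - r\<bar> \<le> \<delta>} \<le> card {\<lceil>r - \<delta>\<rceil>..\<lfloor>r + \<delta>\<rfloor>}"
    by (meson card_image_le card_mono finite_atLeastAtMost_int finite_imageI order_trans)
  then have "real (card {i::nat. \<bar>real i - r\<bar> \<le> \<delta>}) \<le> nat (\<lfloor>r + \<delta>\<rfloor> - \<lceil>r - \<delta>\<rceil> + 1)"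
    by simp
  also have "\<dots> \<le> 2 * \<delta> + 1"
    using assms by (cases "\<lfloor>r + \<delta>\<rfloor> - \<lceil>r - \<delta>\<rceil> + 1 \<ge> 0") (simp, linarith, simp)
  finally show "real (card {i::nat. \<bar>real i - r\<bar> \<le> \<delta>}) \<le> 2 * \<delta> + 1" .
qed

section \<open>Normalised counting densities and their ultralimits\<close>

locale loeb = ultra +
  fixes n :: "nat \<Rightarrow> nat"
  assumes strict_mono_n: "strict_mono n" and n_pos: "\<And>k. 0 < n k"
begin

text \<open>The normalised counting measure of stage \<open>k\<close>. Intersecting with
  \<open>{1..n k}\<close> allows \<open>S\<close> to be given by a bare predicate on the
  naturals.\<close>

definition dens :: "nat \<Rightarrow> nat set \<Rightarrow> real" where
  "dens k S = card (S \<inter> {1..n k}) / n k"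

lemma dens_bounds: "dens k S \<in> {0..1}"
  using n_pos[of k] card_mono[of "{1..n k}" "S \<inter> {1..n k}"] by (auto simp: dens_def)

lemma dens_mono: "S \<inter> {1..n k} \<subseteq> T \<Longrightarrow> dens k S \<le> dens k T"
  unfolding dens_def by (intro divide_right_mono of_nat_mono card_mono) auto

lemma dens_Un_le: "dens k (S \<union> T) \<le> dens k S + dens k T"
  using card_Un_le[of "S \<inter> {1..n k}" "T \<inter> {1..n k}"]
  unfolding dens_def Int_Un_distrib2 add_divide_distrib[symmetric] of_nat_add[symmetric]
  by (intro divide_right_mono of_nat_mono) auto

lemma dens_UN_disjoint:
  assumes "finite C" "disjoint_family_on S C"
  shows "dens k (\<Union>c\<in>C. S c) = (\<Sum>c\<in>C. dens k (S c))"
proof -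
  have "card ((\<Union>c\<in>C. S c) \<inter> {1..n k}) = (\<Sum>c\<in>C. card (S c \<inter> {1..n k}))"
    using assms
    by (subst card_UN_disjoint[symmetric]) (auto simp: disjoint_family_on_def intro!: arg_cong[where f=card])
  then show ?thesis
    by (simp add: dens_def sum_divide_distrib)
qed

lemma dens_permute:
  assumes "q permutes {1..n k}"
  shows "dens k (q -` S) = dens k S" "dens k (q ` S) = dens k S"
proof -
  have "q ` (S \<inter> {1..n k}) = q ` S \<inter> {1..n k}" for S
    by (simp only: image_Int[OF permutes_inj[OF assms]] permutes_image[OF assms])
  then have *: "dens k (q ` S) = dens k S" for S
    unfolding dens_def by (metis assms card_image permutes_inj_on)
  show "dens k (q ` S) = dens k S" by (rule *)
  show "dens k (q -` S) = dens k S"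
    using *[of "q -` S"] by (simp add: permutes_surj[OF assms] surj_image_vimage_eq)
qed

lemma n_at_top: "filterlim (\<lambda>k. real (n k)) at_top \<omega>"
  by (rule filterlim_compose[OF filterlim_real_sequentially
        filterlim_mono[OF filterlim_subseq[OF strict_mono_n] order_refl le_sequentially]])

lemma one_div_n: "((\<lambda>k. 1 / real (n k)) \<longlongrightarrow> 0) \<omega>"
  using tendsto_inverse_0_at_top[OF n_at_top] by (simp add: divide_inverse)

lemma tendsto_unique': "(f \<longlongrightarrow> a) \<omega> \<Longrightarrow> (f \<longlongrightarrow> (b :: real)) \<omega> \<Longrightarrow> a = b"
  by (rule tendsto_unique[OF not_bot])

lemma dens_convergent: "((\<lambda>k. dens k (S k)) \<longlongrightarrow> Lim \<omega> (\<lambda>k. dens k (S k))) \<omega>"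
  by (metis dens_bounds bounded_convergent tendsto_Lim not_bot)

lemma loeb_seqs_iff: "x \<in> loeb_seqs n \<longleftrightarrow> (\<forall>k. x k \<in> {1..n k})"
  by (auto simp: loeb_seqs_def PiE_UNIV_domain)

lemma frac_convergent:
  assumes "x \<in> loeb_seqs n"
  shows "((\<lambda>k. real (x k) / n k) \<longlongrightarrow> Lim \<omega> (\<lambda>k. real (x k) / n k)) \<omega>"
    "Lim \<omega> (\<lambda>k. real (x k) / n k) \<in> {0..1}"
proof -
  have "real (x k) / n k \<in> {0..1}" for k
    using assms n_pos[of k] by (auto simp: loeb_seqs_iff)
  then obtain l where l: "l \<in> {0..1}" "((\<lambda>k. real (x k) / n k) \<longlongrightarrow> l) \<omega>"
    by (rule bounded_convergent[of "\<lambda>k. real (x k) / n k"])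
  then show "((\<lambda>k. real (x k) / n k) \<longlongrightarrow> Lim \<omega> (\<lambda>k. real (x k) / n k)) \<omega>"
    "Lim \<omega> (\<lambda>k. real (x k) / n k) \<in> {0..1}"
    using tendsto_Lim[OF not_bot l(2)] l by simp_all
qed

section \<open>Loeb classes, standard parts and internal sets\<close>

lemma loeb_class_iff:
  "x \<in> loeb_seqs n \<Longrightarrow> y \<in> loeb_class \<omega> n x \<longleftrightarrow> y \<in> loeb_seqs n \<and> (\<forall>\<^sub>F k in \<omega>. x k = y k)"
  by (auto simp: loeb_class_def loeb_rel_def)

lemma loeb_class_eq_iff:
  assumes "x \<in> loeb_seqs n" "y \<in> loeb_seqs n"
  shows "loeb_class \<omega> n x = loeb_class \<omega> n y \<longleftrightarrow> (\<forall>\<^sub>F k in \<omega>. x k = y k)"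
proof
  assume "loeb_class \<omega> n x = loeb_class \<omega> n y"
  moreover have "y \<in> loeb_class \<omega> n y"
    using assms by (simp add: loeb_class_iff)
  ultimately have "y \<in> loeb_class \<omega> n x" by simp
  then show "\<forall>\<^sub>F k in \<omega>. x k = y k"
    using assms by (simp add: loeb_class_iff)
next
  assume *: "\<forall>\<^sub>F k in \<omega>. x k = y k"
  have "(\<forall>\<^sub>F k in \<omega>. x k = z k) \<longleftrightarrow> (\<forall>\<^sub>F k in \<omega>. y k = z k)" for z
    by (rule eventually_subst) (use * in \<open>eventually_elim, simp\<close>)
  then show "loeb_class \<omega> n x = loeb_class \<omega> n y"
    using assms by (auto simp: loeb_class_iff)
qed

lemma loeb_space_conv: "loeb_space \<omega> n = loeb_class \<omega> n ` loeb_seqs n"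
  by (auto simp: loeb_space_def quotient_def loeb_class_def)

text \<open>Equivalent sequences have the same ultralimits, so quantifying over all representatives
  adds nothing. As \<open>Lim\<close> is itself a definite description of the limit, both sides
  describe the same number.\<close>

lemma standard_part_loeb_class:
  assumes "x \<in> loeb_seqs n"
  shows "standard_part \<omega> n (loeb_class \<omega> n x) = Lim \<omega> (\<lambda>k. real (x k) / n k)"
proof -
  have "((\<lambda>k. real (y k) / n k) \<longlongrightarrow> l) \<omega> \<longleftrightarrow> ((\<lambda>k. real (x k) / n k) \<longlongrightarrow> l) \<omega>"
    if "y \<in> loeb_class \<omega> n x" for y l
  proof (rule tendsto_cong)
    show "\<forall>\<^sub>F k in \<omega>. real (y k) / n k = real (x k) / n k"
      using that assms by (auto simp: loeb_class_iff elim: eventually_mono)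
  qed
  moreover have "x \<in> loeb_class \<omega> n x"
    using assms by (simp add: loeb_class_iff)
  ultimately have "(\<forall>y\<in>loeb_class \<omega> n x. ((\<lambda>k. real (y k) / n k) \<longlongrightarrow> l) \<omega>) \<longleftrightarrow>
      ((\<lambda>k. real (x k) / n k) \<longlongrightarrow> l) \<omega>" for l
    by blast
  then show ?thesis
    unfolding standard_part_def Topological_Spaces.Lim_def by simp
qed

lemma loeb_action_loeb_class:
  assumes "x \<in> loeb_seqs n" "\<And>k. q k permutes {1..n k}"
  shows "loeb_action \<omega> n q (loeb_class \<omega> n x) = loeb_class \<omega> n (\<lambda>k. q k (x k))"
proof -
  have in_seqs: "(\<lambda>k. q k (y k)) \<in> loeb_seqs n" if "y \<in> loeb_seqs n" for y
    using that assms(2) by (auto simp: loeb_seqs_iff permutes_in_image simp del: atLeastAtMost_iff)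
  have "loeb_class \<omega> n (\<lambda>k. q k (y k)) = loeb_class \<omega> n (\<lambda>k. q k (x k))"
    if "y \<in> loeb_class \<omega> n x" for y
    using that assms in_seqs
    by (subst loeb_class_eq_iff) (auto simp: loeb_class_iff elim: eventually_mono)
  moreover have "x \<in> loeb_class \<omega> n x"
    using assms by (simp add: loeb_class_iff)
  ultimately show ?thesis
    unfolding loeb_action_def by blast
qed

lemma loeb_class_in_internal_set:
  assumes "x \<in> loeb_seqs n"
  shows "loeb_class \<omega> n x \<in> internal_set \<omega> n A \<longleftrightarrow> (\<forall>\<^sub>F k in \<omega>. x k \<in> A k)"
proof
  assume "loeb_class \<omega> n x \<in> internal_set \<omega> n A"
  then obtain y where y: "y \<in> loeb_seqs n" "\<forall>\<^sub>F k in \<omega>. y k \<in> A k"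
    "loeb_class \<omega> n x = loeb_class \<omega> n y"
    by (auto simp: internal_set_def)
  then have "\<forall>\<^sub>F k in \<omega>. x k = y k"
    using assms by (simp add: loeb_class_eq_iff)
  with y(2) show "\<forall>\<^sub>F k in \<omega>. x k \<in> A k"
    by eventually_elim simp
qed (use assms in \<open>auto simp: internal_set_def\<close>)

lemma internal_set_subset: "internal_set \<omega> n A \<subseteq> loeb_space \<omega> n"
  by (auto simp: internal_set_def loeb_space_conv)

text \<open>If the sides differ at almost every stage, a sequence chosen in their symmetric
  differences has a class lying in exactly one of the two internal sets. This makes the description
  in \<open>loeb_premeasure\<close> unambiguous.\<close>

lemma internal_set_inject:
  assumes "\<And>k. A k \<subseteq> {1..n k}" "\<And>k. B k \<subseteq> {1..n k}"
    and eq: "internal_set \<omega> n A = internal_set \<omega> n B"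
  shows "\<forall>\<^sub>F k in \<omega>. A k = B k"
proof (rule ccontr)
  assume "\<not> (\<forall>\<^sub>F k in \<omega>. A k = B k)"
  then have ne: "\<forall>\<^sub>F k in \<omega>. A k \<noteq> B k"
    by (simp add: not_eventually_iff)
  \<comment> \<open>The value 1 at stages where the sets agree only keeps \<open>x\<close> inside
    \<open>{1..n k}\<close>.\<close>
  define x where "x k = (if A k = B k then 1 else SOME i. i \<in> A k - B k \<union> (B k - A k))" for k
  have x: "x k \<in> A k - B k \<union> (B k - A k)" if "A k \<noteq> B k" for k
    unfolding x_def if_not_P[OF that] by (rule someI_ex) (use that in auto)
  have "x \<in> loeb_seqs n"
    unfolding loeb_seqs_iff
  proof
    fix k show "x k \<in> {1..n k}"
    proof (cases "A k = B k")
      case True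
      then show ?thesis using n_pos[of k] by (simp add: x_def)
    next
      case False
      then show ?thesis using x[OF False] assms(1)[of k] assms(2)[of k] by blast
    qed
  qed
  then have "(\<forall>\<^sub>F k in \<omega>. x k \<in> A k) \<longleftrightarrow> (\<forall>\<^sub>F k in \<omega>. x k \<in> B k)"
    using eq by (metis loeb_class_in_internal_set)
  moreover have "(\<forall>\<^sub>F k in \<omega>. x k \<in> B k) \<longleftrightarrow> (\<forall>\<^sub>F k in \<omega>. x k \<notin> A k)"
    by (rule eventually_subst) (use ne in \<open>eventually_elim, use x in blast\<close>)
  ultimately show False
    by (metis not_eventually_iff)
qed

lemma loeb_premeasure_internal_set:
  assumes "\<And>k. A k \<subseteq> {1..n k}"
  shows "loeb_premeasure \<omega> n (internal_set \<omega> n A) = ennreal (Lim \<omega> (\<lambda>k. dens k (A k)))"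
proof -
  have dens: "dens k (B k) = card (B k) / n k" if "\<And>k. B k \<subseteq> {1..n k}" for B k
    unfolding dens_def using that[of k] by (simp add: Int_absorb2)
  have "m = Lim \<omega> (\<lambda>k. dens k (A k))"
    if B: "\<forall>k. B k \<subseteq> {1..n k}" "internal_set \<omega> n A = internal_set \<omega> n B"
      and m: "((\<lambda>k. card (B k) / n k) \<longlongrightarrow> m) \<omega>" for m B
  proof -
    have "\<forall>\<^sub>F k in \<omega>. card (B k) / n k = dens k (A k)"
      using internal_set_inject[OF assms, of B] B
      by (auto simp: dens[OF assms] elim: eventually_mono)
    then have "((\<lambda>k. dens k (A k)) \<longlongrightarrow> m) \<omega>"
      using m by (simp cong: tendsto_cong)
    then show ?thesis
      by (simp add: tendsto_Lim)
  qed
  then have "(THE m. \<exists>B. (\<forall>k. B k \<subseteq> {1..n k}) \<and> internal_set \<omega> n A = internal_set \<omega> n B \<and>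
      ((\<lambda>k. real (card (B k)) / real (n k)) \<longlongrightarrow> m) \<omega>) = Lim \<omega> (\<lambda>k. dens k (A k))"
    using dens_convergent[of A] assms by (intro the_equality exI[of _ A]) (auto simp: dens[OF assms])
  then show ?thesis
    by (simp add: loeb_premeasure_def)
qed

section \<open>Criteria for almost-everywhere statements on the Loeb space\<close>

lemma internal_sets_subset: "internal_sets \<omega> n \<subseteq> Pow (loeb_space \<omega> n)"
  using internal_set_subset by (auto simp: internal_sets_def)

lemma space_loeb_measure: "space (loeb_measure \<omega> n) = loeb_space \<omega> n"
  unfolding loeb_measure_def space_completion by (rule space_measure_of[OF internal_sets_subset])

text \<open>If the outer measure failed to be countably additive, \<^const>\<open>measure_of\<close> would return the
  zero measure; the following bounds hold in either case, so countable additivity is irrelevant.\<close>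

lemma emeasure_internal_set_le:
  assumes "\<And>k. A k \<subseteq> {1..n k}"
  shows "emeasure (measure_of (loeb_space \<omega> n) (internal_sets \<omega> n)
       (outer_measure (internal_sets \<omega> n) (loeb_premeasure \<omega> n))) (internal_set \<omega> n A)
    \<le> ennreal (Lim \<omega> (\<lambda>k. dens k (A k)))"
proof -
  \<comment> \<open>The outer measure ranges over countable disjoint covers: \<open>A\<close>
    itself, followed by empty sets of pre-measure 0, is one of them.\<close>
  define E where "E j = (if j = 0 then A else (\<lambda>_. {}))" for j :: nat
  have E: "E j k \<subseteq> {1..n k}" for j k
    using assms by (simp add: E_def)
  have empty: "internal_set \<omega> n (\<lambda>_. {}) = {}"
    by (simp add: internal_set_def)
  have "outer_measure (internal_sets \<omega> n) (loeb_premeasure \<omega> n) (internal_set \<omega> n A)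
      \<le> (\<Sum>j. loeb_premeasure \<omega> n (internal_set \<omega> n (E j)))"
    unfolding outer_measure_def
  proof (rule INF_lower, intro CollectI conjI)
    show "range (\<lambda>j. internal_set \<omega> n (E j)) \<subseteq> internal_sets \<omega> n"
      using E by (auto simp: internal_sets_def)
    show "disjoint_family (\<lambda>j. internal_set \<omega> n (E j))"
      by (auto simp: disjoint_family_on_def E_def empty)
    show "internal_set \<omega> n A \<subseteq> (\<Union>j. internal_set \<omega> n (E j))"
      by (auto simp: E_def)
  qed
  also have "\<dots> = (\<Sum>j\<in>{0}. loeb_premeasure \<omega> n (internal_set \<omega> n (E j)))"
  proof (rule suminf_finite)
    fix j :: nat assume "j \<notin> {0}"
    then have "loeb_premeasure \<omega> n (internal_set \<omega> n (E j)) = ennreal (Lim \<omega> (\<lambda>k. dens k (E j k)))"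
      using E by (intro loeb_premeasure_internal_set) auto
    also have "\<dots> = 0"
      using \<open>j \<notin> {0}\<close> by (simp add: E_def dens_def tendsto_Lim[OF not_bot tendsto_const])
    finally show "loeb_premeasure \<omega> n (internal_set \<omega> n (E j)) = 0" .
  qed auto
  also have "\<dots> = ennreal (Lim \<omega> (\<lambda>k. dens k (A k)))"
    using assms by (simp add: E_def loeb_premeasure_internal_set)
  finally show ?thesis
    by (subst emeasure_measure_of_conv) auto
qed

text \<open>The exceptional set is covered by internal sets of measure at most
  \<open>1 / Suc j\<close> for every \<open>j\<close>. Their countable intersection is measurable
  and null. This reduces almost-everywhere statements to estimates of densities at the finite
  stages.\<close>

lemma AE_loebI:
  assumes "\<And>e. 0 < e \<Longrightarrow> \<exists>A. (\<forall>k. A k \<subseteq> {1..n k}) \<and> (\<forall>\<^sub>F k in \<omega>. dens k (A k) \<le> e) \<and>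
    (\<forall>x\<in>loeb_seqs n. \<not> P (loeb_class \<omega> n x) \<longrightarrow> (\<forall>\<^sub>F k in \<omega>. x k \<in> A k))"
  shows "AE x in loeb_measure \<omega> n. P x"
proof -
  define M where "M = measure_of (loeb_space \<omega> n) (internal_sets \<omega> n)
       (outer_measure (internal_sets \<omega> n) (loeb_premeasure \<omega> n))"
  have "\<exists>A. (\<forall>k. A k \<subseteq> {1..n k}) \<and> (\<forall>\<^sub>F k in \<omega>. dens k (A k) \<le> 1 / Suc j) \<and>
    (\<forall>x\<in>loeb_seqs n. \<not> P (loeb_class \<omega> n x) \<longrightarrow> (\<forall>\<^sub>F k in \<omega>. x k \<in> A k))" for j :: nat
    by (rule assms) simp
  then obtain A where A: "\<And>j k. A j k \<subseteq> {1..n k}" "\<And>j. \<forall>\<^sub>F k in \<omega>. dens k (A j k) \<le> 1 / Suc j"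
    "\<And>j x. x \<in> loeb_seqs n \<Longrightarrow> \<not> P (loeb_class \<omega> n x) \<Longrightarrow> \<forall>\<^sub>F k in \<omega>. x k \<in> A j k"
    by metis
  have sets: "internal_set \<omega> n (A j) \<in> sets M" for j
    unfolding M_def sets_measure_of[OF internal_sets_subset]
    by (rule sigma_sets.Basic) (use A(1) in \<open>auto simp: internal_sets_def\<close>)
  define N where "N = (\<Inter>j. internal_set \<omega> n (A j))"
  have N: "N \<in> sets M"
    unfolding N_def using sets by auto
  have le: "emeasure M N \<le> ennreal (1 / Suc j)" for j
  proof -
    have "emeasure M N \<le> emeasure M (internal_set \<omega> n (A j))"
      using sets by (intro emeasure_mono) (auto simp: N_def)
    also have "\<dots> \<le> ennreal (Lim \<omega> (\<lambda>k. dens k (A j k)))"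
      unfolding M_def using A(1) by (intro emeasure_internal_set_le) auto
    also have "\<dots> \<le> ennreal (1 / Suc j)"
      by (intro ennreal_leI tendsto_upperbound[OF dens_convergent A(2)]) simp
    finally show ?thesis .
  qed
  have "(\<lambda>j. ennreal (1 / Suc j)) \<longlonglongrightarrow> ennreal 0"
    by (intro tendsto_ennrealI) real_asymp
  then have "emeasure M N \<le> 0"
    using le by (intro LIMSEQ_le_const) auto
  then have "N \<in> null_sets M"
    using N by (auto simp: null_sets_def)
  then have "AE x in M. P x"
  proof (rule AE_I')
    have "space M = loeb_class \<omega> n ` loeb_seqs n"
      unfolding M_def space_measure_of[OF internal_sets_subset] by (rule loeb_space_conv)
    then show "{x \<in> space M. \<not> P x} \<subseteq> N"
      using A(3) by (auto simp: N_def loeb_class_in_internal_set)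
  qed
  then show ?thesis
    unfolding loeb_measure_def M_def by (rule AE_completion)
qed

text \<open>The same internal set serves for every bound \<open>e\<close> when its density tends to
  0; by the ultrafilter property, a sequence not eventually outside it is eventually inside.\<close>

lemma AE_loeb_small:
  assumes "((\<lambda>k. dens k (A k)) \<longlongrightarrow> 0) \<omega>"
    and "\<And>x. x \<in> loeb_seqs n \<Longrightarrow> \<forall>\<^sub>F k in \<omega>. x k \<notin> A k \<Longrightarrow> P (loeb_class \<omega> n x)"
  shows "AE x in loeb_measure \<omega> n. P x"
proof (rule AE_loebI, rule exI, intro conjI allI ballI impI)
  fix e :: real assume "0 < e"
  then have "\<forall>\<^sub>F k in \<omega>. dens k (A k) < e"
    using assms(1) by (simp add: order_tendsto_iff)
  then show "\<forall>\<^sub>F k in \<omega>. dens k (A k \<inter> {1..n k}) \<le> e"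
    by eventually_elim (simp add: dens_def)
  fix x assume "x \<in> loeb_seqs n" "\<not> P (loeb_class \<omega> n x)"
  then have "\<not> (\<forall>\<^sub>F k in \<omega>. x k \<notin> A k)"
    using assms(2) by blast
  then have "\<forall>\<^sub>F k in \<omega>. x k \<in> A k"
    by (simp add: not_eventually_iff)
  then show "\<forall>\<^sub>F k in \<omega>. x k \<in> A k \<inter> {1..n k}"
    using \<open>x \<in> loeb_seqs n\<close> by (auto simp: loeb_seqs_iff elim: eventually_mono)
qed auto

lemma AE_standard_part_neq: "AE x in loeb_measure \<omega> n. standard_part \<omega> n x \<noteq> d"
proof (rule AE_loebI)
  fix e :: real assume e: "0 < e"
  \<comment> \<open>An interval of radius \<open>e / 4\<close> contributes density at most
    \<open>e / 2 + 1 / n k\<close>, and the last term is eventually below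
    \<open>e / 2\<close>.\<close>
  define A where "A k = {i. \<bar>real i - d * n k\<bar> \<le> e / 4 * n k} \<inter> {1..n k}" for k
  have "\<forall>\<^sub>F k in \<omega>. 1 / real (n k) < e / 2"
    using one_div_n e by (intro order_tendstoD) auto
  then have "\<forall>\<^sub>F k in \<omega>. dens k (A k) \<le> e"
  proof eventually_elim
    fix k assume k: "1 / real (n k) < e / 2"
    have "dens k (A k) \<le> card {i::nat. \<bar>real i - d * n k\<bar> \<le> e / 4 * n k} / n k"
      unfolding dens_def A_def by (intro divide_right_mono of_nat_mono card_mono card_near) (use e in auto)
    also have "\<dots> \<le> (2 * (e / 4 * n k) + 1) / n k"
      using e by (intro divide_right_mono card_near) auto
    also have "\<dots> = e / 2 + 1 / n k"
      using n_pos[of k] by (simp add: field_simps)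
    finally show "dens k (A k) \<le> e"
      using k by simp
  qed
  moreover have "\<forall>\<^sub>F k in \<omega>. x k \<in> A k"
    if x: "x \<in> loeb_seqs n" and d: "standard_part \<omega> n (loeb_class \<omega> n x) = d" for x
  proof -
    have "((\<lambda>k. real (x k) / n k) \<longlongrightarrow> d) \<omega>"
      using frac_convergent(1)[OF x] d by (simp add: standard_part_loeb_class x)
    then have "\<forall>\<^sub>F k in \<omega>. dist (real (x k) / n k) d < e / 4"
      using e by (intro tendstoD) auto
    then show ?thesis
    proof eventually_elim
      fix k assume "dist (real (x k) / n k) d < e / 4"
      then have "\<bar>real (x k) / n k - d\<bar> * n k \<le> e / 4 * n k"
        by (intro mult_right_mono) (auto simp: dist_real_def)
      moreover have "\<bar>real (x k) / n k - d\<bar> * n k = \<bar>real (x k) - d * n k\<bar>"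
        using n_pos[of k] by (simp add: abs_if field_simps)
      ultimately show "x k \<in> A k"
        using x by (auto simp: A_def loeb_seqs_iff)
    qed
  qed
  ultimately show "\<exists>A. (\<forall>k. A k \<subseteq> {1..n k}) \<and> (\<forall>\<^sub>F k in \<omega>. dens k (A k) \<le> e) \<and>
    (\<forall>x\<in>loeb_seqs n. \<not> standard_part \<omega> n (loeb_class \<omega> n x) \<noteq> d \<longrightarrow> (\<forall>\<^sub>F k in \<omega>. x k \<in> A k))"
    by (intro exI[of _ A]) (auto simp: A_def)
qed

end

section \<open>Sorting permutations and bit sequences\<close>

text \<open>The first bits are read as a binary number with the most significant bit first, so that
  the order of the naturals is the lexicographic order of prefixes of equal length.\<close>

primrec prefix :: "(nat \<Rightarrow> bool) \<Rightarrow> nat \<Rightarrow> nat" where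
  "prefix s 0 = 0"
| "prefix s (Suc m) = 2 * prefix s m + of_bool (s m)"

lemma prefix_less: "prefix s m < 2 ^ m"
  by (induction m) auto

lemma prefix_eq_iff: "prefix s m = prefix s' m \<longleftrightarrow> (\<forall>j<m. s j = s' j)"
proof (induction m)
  case (Suc m)
  have "prefix s (Suc m) = prefix s' (Suc m) \<longleftrightarrow> prefix s m = prefix s' m \<and> s m = s' m"
    by (cases "s m"; cases "s' m") (simp; presburger)+
  with Suc show ?case
    by (auto simp: less_Suc_eq)
qed simp

text \<open>Dropping the last bit is halving, which is monotone. Hence sorting by long prefixes also
  sorts by all shorter ones.\<close>

lemma prefix_le_prefix:
  assumes "m \<le> k" "prefix s k \<le> prefix s' k"
  shows "prefix s m \<le> prefix s' m"
  using assms
proof (induction rule: inc_induct)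
  case (step k)
  then show ?case
    by (cases "s k"; cases "s' k") auto
qed

text \<open>Here \<open>c k i m\<close> is bit \<open>m\<close> of the point \<open>i\<close> at
  stage \<open>k\<close>, and \<open>p k\<close> sorts the points by their first \<open>k\<close>
  bits. The assumption \<open>small\<close> says that the bits separate points: at some depth all
  cylinders have small limit density.\<close>

locale coding = loeb +
  fixes c :: "nat \<Rightarrow> nat \<Rightarrow> nat \<Rightarrow> bool" and p :: "nat \<Rightarrow> nat \<Rightarrow> nat"
  assumes p_permutes: "\<And>k. p k permutes {1..n k}"
    and p_mono: "\<And>k i i'. i \<in> {1..n k} \<Longrightarrow> i' \<in> {1..n k} \<Longrightarrow> p k i \<le> p k i' \<Longrightarrow>
      prefix (c k i) k \<le> prefix (c k i') k"
    and small: "\<And>e. 0 < e \<Longrightarrow> \<exists>m. \<forall>x. \<forall>\<^sub>F k in \<omega>. dens k {i. prefix (c k i) m = x} \<le> e"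
begin

text \<open>A limiting distribution function: sorting carries the cylinder with prefix
  \<open>x\<close> at depth \<open>m\<close> to the interval from \<open>lev m x\<close> to
  \<open>lev m (Suc x)\<close>.\<close>

definition lev :: "nat \<Rightarrow> nat \<Rightarrow> real" where
  "lev m x = Lim \<omega> (\<lambda>k. dens k {i. prefix (c k i) m < x})"

definition enc :: "(nat \<Rightarrow> nat) \<Rightarrow> nat \<Rightarrow> bool" where
  "enc y m \<longleftrightarrow> (\<forall>\<^sub>F k in \<omega>. c k (y k) m)"

definition pos :: "(nat \<Rightarrow> nat) \<Rightarrow> real" where
  "pos y = Lim \<omega> (\<lambda>k. real (p k (y k)) / n k)"

text \<open>The last bit of a prefix is its parity, so bit \<open>m\<close> is set exactly on the
  open intervals of odd index at depth \<open>Suc m\<close>. Endpoints at that depth get the value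
  \<open>False\<close>.\<close>

definition digits :: "real \<Rightarrow> nat \<Rightarrow> bool" where
  "digits t m \<longleftrightarrow> (\<exists>x. odd x \<and> lev (Suc m) x < t \<and> t < lev (Suc m) (Suc x))"

text \<open>The left endpoints of the nested intervals increase to the coded point. A countable
  supremum is defined for every bit sequence and is visibly measurable.\<close>

definition dec :: "(nat \<Rightarrow> bool) \<Rightarrow> real" where
  "dec s = (SUP m. lev m (prefix s m))"

text \<open>The points with ambiguous digits. The set is countable, hence negligible both for
  Lebesgue measure and for standard parts of Loeb points.\<close>

definition levels :: "real set" where
  "levels = (\<Union>m. range (lev m))"

lemma countable_levels: "countable levels"
  by (simp add: levels_def)

lemma lev_in_levels [simp]: "lev m x \<in> levels"
  by (auto simp: levels_def)

lemma tendsto_lev: "((\<lambda>k. dens k {i. prefix (c k i) m < x}) \<longlongrightarrow> lev m x) \<omega>"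
  unfolding lev_def by (rule dens_convergent)

lemma lev_bounds: "0 \<le> lev m x" "lev m x \<le> 1"
  using dens_bounds
  by (auto intro!: tendsto_lowerbound[OF tendsto_lev] tendsto_upperbound[OF tendsto_lev] always_eventually)

lemma lev_0 [simp]: "lev m 0 = 0"
  using tendsto_unique'[OF tendsto_lev[of m 0], of 0] by (simp add: dens_def)

lemma lev_0_1 [simp]: "lev 0 (Suc 0) = 1"
  using tendsto_unique'[OF tendsto_lev[of 0 1], of 1] n_pos by (simp add: dens_def n_pos[THEN gr_implies_not0])

lemma lev_mono: "x \<le> y \<Longrightarrow> lev m x \<le> lev m y"
  by (rule tendsto_le[OF not_bot tendsto_lev tendsto_lev]) (auto intro!: always_eventually dens_mono)

text \<open>Interval \<open>x\<close> splits into the intervals \<open>2 * x\<close> and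
  \<open>2 * x + 1\<close> of the next depth, and old endpoints remain endpoints.\<close>

lemma lev_refine: "lev (Suc m) (2 * x) = lev m x"
proof -
  have "prefix s (Suc m) < 2 * x \<longleftrightarrow> prefix s m < x" for s
    by (cases "s m") auto
  then show ?thesis
    unfolding lev_def by simp
qed

lemma tendsto_cylinder:
  "((\<lambda>k. dens k {i. prefix (c k i) m = x}) \<longlongrightarrow> lev m (Suc x) - lev m x) \<omega>"
proof -
  have "dens k {i. prefix (c k i) m < Suc x} =
      dens k {i. prefix (c k i) m < x} + dens k {i. prefix (c k i) m = x}" for k
  proof -
    have "{i. prefix (c k i) m < Suc x} = {i. prefix (c k i) m < x} \<union> {i. prefix (c k i) m = x}"
      by auto
    then show ?thesis
      using dens_UN_disjoint[of UNIV "\<lambda>b. if b then {i. prefix (c k i) m < x} else {i. prefix (c k i) m = x}" k]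
      by (simp add: UNIV_bool disjoint_family_on_def Un_commute add.commute disjoint_iff)
  qed
  then have "(\<lambda>k. dens k {i. prefix (c k i) m = x}) =
      (\<lambda>k. dens k {i. prefix (c k i) m < Suc x} - dens k {i. prefix (c k i) m < x})"
    by auto
  then show ?thesis
    by (simp only: tendsto_diff[OF tendsto_lev tendsto_lev])
qed

lemma lev_gap:
  assumes "0 < e"
  obtains m where "\<And>x. lev m (Suc x) - lev m x \<le> e"
proof -
  from small[OF assms] obtain m where "\<forall>x. \<forall>\<^sub>F k in \<omega>. dens k {i. prefix (c k i) m = x} \<le> e" ..
  then have "lev m (Suc x) - lev m x \<le> e" for x
    by (intro tendsto_upperbound[OF tendsto_cylinder _ not_bot]) simp
  then show ?thesis by (rule that)
qed

lemma lev_interval_unique: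
  assumes "lev m x < t" "t < lev m (Suc x)" "lev m y < t" "t < lev m (Suc y)"
  shows "x = y"
proof (rule ccontr)
  assume "x \<noteq> y"
  then consider "Suc x \<le> y" | "Suc y \<le> x" by linarith
  then show False
    using assms lev_mono[of "Suc x" y m] lev_mono[of "Suc y" x m] by cases auto
qed

text \<open>For \<open>m \<le> k\<close> the sorting permutation sends the points with prefix below
  \<open>x\<close> onto an initial segment of \<open>{1..n k}\<close>. Membership can therefore be
  read off by comparing the position with the cardinality of this set.\<close>

lemma prefix_less_iff:
  assumes "m \<le> k" "i \<in> {1..n k}"
  shows "prefix (c k i) m < x \<longleftrightarrow> p k i / n k \<le> dens k {i. prefix (c k i) m < x}"
proof -
  define B where "B = {i. prefix (c k i) m < x} \<inter> {1..n k}"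
  \<comment> \<open>The image of \<open>B\<close> is closed downwards because \<open>p k\<close> is
    sorted; a downward closed subset of \<open>{1..n k}\<close> is determined by its
    cardinality.\<close>
  have down: "j \<in> p k ` B" if j: "j' \<in> p k ` B" "1 \<le> j" "j \<le> j'" for j j'
  proof -
    obtain i' where i': "i' \<in> B" "j' = p k i'"
      using j(1) by blast
    then have "j' \<in> {1..n k}"
      using permutes_in_image[OF p_permutes[of k], of i'] by (auto simp: B_def)
    then have "j \<in> p k ` {1..n k}"
      using j permutes_image[OF p_permutes[of k]] by auto
    then obtain i where i: "i \<in> {1..n k}" "j = p k i"
      by blast
    have "prefix (c k i) m \<le> prefix (c k i') m"
      by (rule prefix_le_prefix[OF assms(1) p_mono]) (use i i' j in \<open>auto simp: B_def\<close>)
    with i i' show ?thesis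
      by (auto simp: B_def)
  qed
  have card: "card (p k ` B) = card B"
    using permutes_inj_on[OF p_permutes] by (rule card_image)
  have sub: "p k ` B \<subseteq> {1..n k}"
    using permutes_image[OF p_permutes[of k]] by (auto simp: B_def)
  have fin: "finite (p k ` B)"
    using sub finite_subset by blast
  have "p k i \<in> p k ` B \<longleftrightarrow> p k i \<le> card B"
  proof
    assume "p k i \<in> p k ` B"
    then have "{1..p k i} \<subseteq> p k ` B"
      by (meson atLeastAtMost_iff down subsetI)
    then have "card {1..p k i} \<le> card B"
      using card_mono[OF fin] card by metis
    then show "p k i \<le> card B" by simp
  next
    assume le: "p k i \<le> card B"
    show "p k i \<in> p k ` B"
    proof (rule ccontr)
      assume no: "p k i \<notin> p k ` B"
      have "1 \<le> p k i"
        using assms(2) permutes_in_image[OF p_permutes[of k], of i] by auto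
      then have "p k ` B \<subseteq> {1..<p k i}"
        using down no sub by (meson atLeastAtMost_iff atLeastLessThan_iff not_le subset_iff)
      then have "card (p k ` B) \<le> p k i - 1"
        using card_mono[of "{1..<p k i}" "p k ` B"] by simp
      then show False
        using le card \<open>1 \<le> p k i\<close> by linarith
    qed
  qed
  moreover have "p k i \<in> p k ` B \<longleftrightarrow> prefix (c k i) m < x"
    using assms(2) by (simp add: inj_image_mem_iff[OF permutes_inj[OF p_permutes]] B_def)
  ultimately show ?thesis
    using n_pos[of k] by (simp add: dens_def B_def divide_le_cancel)
qed

section \<open>Bit sequence and sorted position of a Loeb point\<close>

lemma prefix_enc: "\<forall>\<^sub>F k in \<omega>. prefix (c k (y k)) m = prefix (enc y) m"
proof (induction m)
  case (Suc m)
  have "\<forall>\<^sub>F k in \<omega>. c k (y k) m = enc y m"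
    using not_eventually_iff[of "\<lambda>k. c k (y k) m"] by (cases "enc y m") (auto simp: enc_def)
  with Suc show ?case
    by eventually_elim simp
qed simp

text \<open>The comparison \<open>prefix_less_iff\<close>, applied with the prefix and with its
  successor, holds at almost every stage. Passing to the ultralimit leaves weak inequalities, so
  \<open>pos y\<close> may still be an endpoint.\<close>

lemma pos_bounds:
  assumes y: "y \<in> loeb_seqs n"
  shows "lev m (prefix (enc y) m) \<le> pos y" "pos y \<le> lev m (Suc (prefix (enc y) m))"
    and "pos y \<in> {0..1}"
proof -
  have yk: "y k \<in> {1..n k}" for k
    using y by (auto simp: loeb_seqs_iff)
  have "(\<lambda>k. p k (y k)) \<in> loeb_seqs n"
    using yk permutes_in_image[OF p_permutes] by (simp add: loeb_seqs_iff)
  note pos = frac_convergent[OF this, folded pos_def]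
  have ev: "\<forall>\<^sub>F k in \<omega>. m \<le> k \<and> prefix (c k (y k)) m = prefix (enc y) m"
    using eventually_ge prefix_enc by (rule eventually_conj)
  then have "\<forall>\<^sub>F k in \<omega>. dens k {i. prefix (c k i) m < prefix (enc y) m} \<le> p k (y k) / n k"
  proof eventually_elim
    case (elim k)
    then show ?case
      using prefix_less_iff[of m k "y k" "prefix (enc y) m"] yk[of k] by auto
  qed
  then show "lev m (prefix (enc y) m) \<le> pos y"
    by (rule tendsto_le[OF not_bot pos(1) tendsto_lev])
  from ev have "\<forall>\<^sub>F k in \<omega>. p k (y k) / n k \<le> dens k {i. prefix (c k i) m < Suc (prefix (enc y) m)}"
  proof eventually_elim
    case (elim k)
    then show ?case
      using prefix_less_iff[of m k "y k" "Suc (prefix (enc y) m)"] yk[of k] by auto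
  qed
  then show "pos y \<le> lev m (Suc (prefix (enc y) m))"
    by (rule tendsto_le[OF not_bot tendsto_lev pos(1)])
  show "pos y \<in> {0..1}" by (rule pos(2))
qed

lemma bdd_above_lev: "bdd_above (range (\<lambda>m. lev m (prefix s m)))"
  using lev_bounds by (auto intro: bdd_aboveI[of _ 1])

lemma dec_bounds: "dec s \<in> {0..1}"
proof -
  have "lev 0 (prefix s 0) \<le> dec s"
    unfolding dec_def by (rule cSUP_upper[OF _ bdd_above_lev]) simp
  moreover have "dec s \<le> 1"
    unfolding dec_def by (rule cSUP_least) (simp_all add: lev_bounds)
  ultimately show ?thesis by simp
qed

text \<open>By \<open>lev_gap\<close> the intervals become arbitrarily short, so only one point lies
  in all the closed intervals belonging to \<open>s\<close>.\<close>

lemma dec_eqI: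
  assumes "\<And>m. lev m (prefix s m) \<le> t" "\<And>m. t \<le> lev m (Suc (prefix s m))"
  shows "dec s = t"
proof (rule antisym)
  show "dec s \<le> t"
    unfolding dec_def by (rule cSUP_least) (simp_all add: assms)
  show "t \<le> dec s"
  proof (rule field_le_epsilon)
    fix e :: real assume "0 < e"
    then obtain m where m: "\<And>x. lev m (Suc x) - lev m x \<le> e"
      using lev_gap by blast
    have "lev m (prefix s m) \<le> dec s"
      unfolding dec_def by (rule cSUP_upper[OF _ bdd_above_lev]) simp
    then show "t \<le> dec s + e"
      using m[of "prefix s m"] assms(2)[of m] by linarith
  qed
qed

lemma dec_enc:
  assumes "y \<in> loeb_seqs n"
  shows "dec (enc y) = pos y"
  using pos_bounds[OF assms] by (intro dec_eqI)

text \<open>Induction on the depth: a point that is not an endpoint lies strictly in one of the two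
  parts of its current interval, and the parity of that part is the next digit.\<close>

lemma prefix_digits:
  assumes t: "t \<in> {0..1} - levels"
  shows "lev m (prefix (digits t) m) < t \<and> t < lev m (Suc (prefix (digits t) m))"
proof (induction m)
  case 0
  have "t \<noteq> lev 0 0" "t \<noteq> lev 0 (Suc 0)"
    using t lev_in_levels by blast+
  then show ?case
    using t by auto
next
  case (Suc m)
  define x where "x = prefix (digits t) m"
  have x: "lev (Suc m) (2 * x) < t" "t < lev (Suc m) (Suc (Suc (2 * x)))"
    using Suc lev_refine[of m x] lev_refine[of m "Suc x"] by (simp_all add: x_def)
  have "t \<noteq> lev (Suc m) (Suc (2 * x))"
    using t lev_in_levels by blast
  then consider "t < lev (Suc m) (Suc (2 * x))" | "lev (Suc m) (Suc (2 * x)) < t"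
    by linarith
  then show ?case
  proof cases
    case 1
    have "\<not> digits t m"
    proof
      assume "digits t m"
      then obtain y where y: "odd y" "lev (Suc m) y < t" "t < lev (Suc m) (Suc y)"
        by (auto simp: digits_def)
      have "y = 2 * x"
        by (rule lev_interval_unique[OF y(2,3) x(1) 1])
      with y(1) show False by simp
    qed
    with 1 x show ?thesis by (simp add: x_def)
  next
    case 2
    then have "digits t m"
      unfolding digits_def by (intro exI[of _ "Suc (2 * x)"]) (simp add: x(2))
    with 2 x show ?thesis by (simp add: x_def)
  qed
qed

lemma prefix_digits_eq_iff:
  assumes "t \<in> {0..1} - levels"
  shows "prefix (digits t) m = x \<longleftrightarrow> lev m x < t \<and> t < lev m (Suc x)"
  using prefix_digits[OF assms, of m] lev_interval_unique by blast

lemma dec_digits: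
  assumes "t \<in> {0..1} - levels"
  shows "dec (digits t) = t"
  using prefix_digits[OF assms] by (intro dec_eqI less_imp_le) auto

text \<open>Away from endpoints the weak bounds on \<open>pos y\<close> are strict, which identifies
  every prefix. Together with \<open>dec_enc\<close>, position and bit sequence determine each
  other.\<close>

lemma digits_pos:
  assumes "y \<in> loeb_seqs n" "pos y \<notin> levels"
  shows "digits (pos y) = enc y"
proof
  fix m
  have "prefix (digits (pos y)) m = prefix (enc y) m" for m
  proof -
    have "pos y \<noteq> lev m (prefix (enc y) m)" "pos y \<noteq> lev m (Suc (prefix (enc y) m))"
      using assms(2) by (metis lev_in_levels)+
    then show ?thesis
      using assms pos_bounds[OF assms(1)]
      by (subst prefix_digits_eq_iff) (auto simp: less_le)
  qed
  then show "digits (pos y) m = enc y m"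
    by (metis prefix_eq_iff lessI)
qed

section \<open>The law of the digits of a uniformly distributed point\<close>

abbreviation I01 :: "real measure" where
  "I01 \<equiv> restrict_space lborel {0..1}"

abbreviation seq_space :: "(nat \<Rightarrow> bool) measure" where
  "seq_space \<equiv> PiM UNIV (\<lambda>_. count_space UNIV)"

definition law :: "(nat \<Rightarrow> bool) measure" where
  "law = distr I01 seq_space digits"

lemma prob_I01: "emeasure I01 {0..1} = 1"
  by (subst emeasure_restrict_space) auto

lemma finite_I01: "finite_measure I01"
  by (rule finite_measureI) (simp add: space_restrict_space prob_I01)

lemma measurable_digits [measurable]: "digits \<in> borel \<rightarrow>\<^sub>M seq_space"
  by (rule measurable_PiM_single') (simp_all add: digits_def)

lemma measurable_digits' [measurable]: "digits \<in> I01 \<rightarrow>\<^sub>M seq_space"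
  using measurable_digits by (simp add: measurable_restrict_space1 measurable_lborel1)

lemma measurable_prefix [measurable]: "(\<lambda>s. prefix s m) \<in> seq_space \<rightarrow>\<^sub>M count_space UNIV"
  by (induction m) simp_all

lemma measurable_dec [measurable]: "dec \<in> seq_space \<rightarrow>\<^sub>M borel"
  unfolding dec_def
  by (rule borel_measurable_cSUP)
    (auto intro: measurable_compose[OF measurable_prefix] bdd_above_lev)

lemma AE_I01_levels: "AE t in I01. t \<in> {0..1} - levels"
proof -
  have "levels \<in> null_sets lborel"
    by (rule countable_imp_null_set_lborel[OF countable_levels])
  then have "AE t in lborel. t \<notin> levels"
    by (rule AE_not_in)
  then show ?thesis
    by (subst AE_restrict_space_iff) auto
qed

lemma AE_dec_digits: "AE t in I01. dec (digits t) = t"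
  using AE_I01_levels by eventually_elim (rule dec_digits)

lemma measure_cylinder:
  "measure I01 {t\<in>{0..1}. prefix (digits t) m = x} = lev m (Suc x) - lev m x"
proof -
  have *: "{t\<in>{0..1}. prefix (digits t) m = x} \<in> sets I01"
    by (subst sets_restrict_space_iff) auto
  have "measure I01 {t\<in>{0..1}. prefix (digits t) m = x} = measure I01 {lev m x<..<lev m (Suc x)}"
  proof (rule measure_eq_AE)
    show "AE t in I01. t \<in> {t\<in>{0..1}. prefix (digits t) m = x} \<longleftrightarrow> t \<in> {lev m x<..<lev m (Suc x)}"
      using AE_I01_levels by eventually_elim (simp add: prefix_digits_eq_iff)
    show "{lev m x<..<lev m (Suc x)} \<in> sets I01"
      using lev_bounds[of m x] lev_bounds[of m "Suc x"] by (subst sets_restrict_space_iff) auto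
  qed (rule *)
  also have "\<dots> = lev m (Suc x) - lev m x"
    using lev_bounds[of m x] lev_bounds[of m "Suc x"] lev_mono[of x "Suc x" m]
    by (subst measure_restrict_space) auto
  finally show ?thesis .
qed

text \<open>A condition on the first \<open>m\<close> bits is a finite disjoint union of cylinders.
  Both the limit density and the Lebesgue measure of a cylinder are the length of its interval, so
  \<open>law\<close> has the limiting counts as finite-dimensional distributions.\<close>

lemma tendsto_law:
  assumes T: "\<And>s s'. (\<And>j. j < m \<Longrightarrow> s j = s' j) \<Longrightarrow> T s \<longleftrightarrow> T s'"
  shows "((\<lambda>k. dens k {i. T (c k i)}) \<longlongrightarrow> measure I01 {t\<in>{0..1}. T (digits t)}) \<omega>"
proof -
  interpret I: finite_measure I01 by (rule finite_I01)
  define C where "C = (\<lambda>s. prefix s m) ` Collect T"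
  have fin: "finite C"
    unfolding C_def using prefix_less by (intro finite_subset[OF _ finite_lessThan[of "2 ^ m"]]) auto
  have TC: "T s \<longleftrightarrow> prefix s m \<in> C" for s
  proof
    assume "prefix s m \<in> C"
    then obtain s' where s': "T s'" "prefix s m = prefix s' m"
      by (auto simp: C_def)
    then show "T s"
      using T[of s s'] by (simp add: prefix_eq_iff)
  qed (simp add: C_def)
  have "dens k {i. T (c k i)} = (\<Sum>x\<in>C. dens k {i. prefix (c k i) m = x})" for k
    by (subst dens_UN_disjoint[symmetric, OF fin])
      (auto simp: disjoint_family_on_def TC intro!: arg_cong[where f="dens k"])
  moreover have "measure I01 {t\<in>{0..1}. T (digits t)} =
      (\<Sum>x\<in>C. measure I01 {t\<in>{0..1}. prefix (digits t) m = x})"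
  proof (subst I.finite_measure_finite_Union[symmetric, OF fin])
    show "(\<lambda>x. {t\<in>{0..1}. prefix (digits t) m = x}) ` C \<subseteq> sets I01"
      by (auto simp: sets_restrict_space_iff)
  qed (auto simp: disjoint_family_on_def TC intro!: arg_cong[where f="measure I01"])
  ultimately show ?thesis
    unfolding measure_cylinder by (simp only: tendsto_sum[OF tendsto_cylinder])
qed

end

section \<open>Shift of the bits as an automorphism of the unit interval\<close>

text \<open>A Lebesgue set is a Borel set together with a subset of a Borel null set. Preservation
  on Borel sets makes the preimage of the latter null, which extends measurability and preservation
  to the completion.\<close>

lemma measure_preserving_lebesgue_on:
  assumes f [measurable]: "f \<in> borel_measurable borel" and f01: "f \<in> S \<rightarrow> S"
    and S: "S \<in> sets borel"
    and pres: "\<And>B. B \<in> sets borel \<Longrightarrow> emeasure lborel (f -` B \<inter> S) = emeasure lborel (B \<inter> S)"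
  shows "measure_preserving (lebesgue_on S) f"
proof -
  have *: "f -` A \<inter> S \<in> sets lebesgue \<and> emeasure lebesgue (f -` A \<inter> S) = emeasure lebesgue A"
    if A: "A \<in> sets lebesgue" "A \<subseteq> S" for A
  proof -
    from A(1) obtain B N N' where B: "A = B \<union> N" "N \<subseteq> N'" "N' \<in> null_sets lborel" "B \<in> sets lborel"
      by (rule sets_completionE)
    have pre: "f -` C \<inter> S \<in> sets borel" if "C \<in> sets borel" for C
      using measurable_sets[OF f that] S by auto
    have "emeasure lborel (f -` N' \<inter> S) = emeasure lborel (N' \<inter> S)"
      using B(3) by (intro pres) (auto simp: null_sets_def)
    also have "\<dots> \<le> emeasure lborel N'"
      using B(3) by (intro emeasure_mono) auto
    also have "\<dots> = 0"
      using B(3) by auto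
    finally have "f -` N' \<inter> S \<in> null_sets lborel"
      using pre[of N'] B(3) by (auto simp: null_sets_def)
    from null_sets_completionI[OF this] have null: "f -` N \<inter> S \<in> null_sets lebesgue"
      by (rule null_sets_completion_subset[rotated]) (use B(2) in auto)
    have null': "N \<in> null_sets lebesgue"
      by (rule null_sets_completion_subset[OF B(2) null_sets_completionI[OF B(3)]])
    have split: "f -` A \<inter> S = f -` B \<inter> S \<union> f -` N \<inter> S"
      using B(1) by auto
    have sets: "f -` B \<inter> S \<in> sets lebesgue" "B \<in> sets lebesgue"
      using pre B(4) by auto
    have "emeasure lebesgue (f -` A \<inter> S) = emeasure lebesgue (f -` B \<inter> S)"
      unfolding split using sets null by (intro emeasure_Un_null_set)
    also have "\<dots> = emeasure lborel (f -` B \<inter> S)"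
      using pre[of B] B(4) by simp
    also have "\<dots> = emeasure lborel (B \<inter> S)"
      using B(4) by (intro pres) simp
    also have "\<dots> = emeasure lebesgue B"
      using B(1,4) A(2) by (simp add: Int_absorb2)
    also have "\<dots> = emeasure lebesgue A"
      unfolding B(1) using sets null' by (intro emeasure_Un_null_set[symmetric])
    finally show ?thesis
      unfolding split using sets(1) null by auto
  qed
  have S': "S \<inter> space lebesgue \<in> sets lebesgue"
    using S by auto
  have sets: "A \<in> sets (lebesgue_on S) \<longleftrightarrow> A \<in> sets lebesgue \<and> A \<subseteq> S" for A
    using sets_restrict_space_iff[OF S'] by auto
  show ?thesis
    unfolding measure_preserving_def
  proof (intro conjI ballI measurableI)
    fix A assume "A \<in> sets (lebesgue_on S)"
    then have A: "A \<in> sets lebesgue" "A \<subseteq> S"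
      by (auto simp: sets)
    show "f -` A \<inter> space (lebesgue_on S) \<in> sets (lebesgue_on S)"
      using *[OF A] by (auto simp: sets space_restrict_space)
    show "emeasure (lebesgue_on S) (f -` A \<inter> space (lebesgue_on S)) = emeasure (lebesgue_on S) A"
      using *[OF A] A by (simp add: space_restrict_space emeasure_restrict_space[OF S'] Int_absorb2)
  qed (use f01 in \<open>auto simp: space_restrict_space\<close>)
qed

context loeb begin

lemma dens_UN_tendsto_0:
  assumes "finite J" "\<And>j. j \<in> J \<Longrightarrow> ((\<lambda>k. dens k (B j k)) \<longlongrightarrow> 0) \<omega>"
  shows "((\<lambda>k. dens k (\<Union>j\<in>J. B j k)) \<longlongrightarrow> 0) \<omega>"
  using assms
proof (induction J rule: finite_induct)
  case (insert j J)
  have lim: "((\<lambda>k. dens k (B j k) + dens k (\<Union>j\<in>J. B j k)) \<longlongrightarrow> 0) \<omega>"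
    using insert by (intro tendsto_eq_intros) auto
  show ?case
    by (rule tendsto_sandwich[OF _ _ tendsto_const lim]) (use dens_Un_le dens_bounds in auto)
qed (simp add: dens_def)

end

context coding begin

text \<open>The candidate for the restriction to the unit interval: read the digits, reindex them by
  \<open>\<sigma>\<close>, decode.\<close>

definition act :: "(nat \<Rightarrow> nat) \<Rightarrow> real \<Rightarrow> real" where
  "act \<sigma> t = dec (digits t \<circ> \<sigma>)"

lemma measurable_shift [measurable]: "(\<lambda>s. s \<circ> \<sigma>) \<in> seq_space \<rightarrow>\<^sub>M seq_space"
  by (rule measurable_PiM_single') (auto simp: comp_def)

text \<open>It suffices to compare finite-dimensional distributions. Applying \<open>q k\<close>
  does not change counts, and outside a set of vanishing density it acts on the finitely many bits
  concerned as reindexing by \<open>\<sigma>\<close>.\<close>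

lemma law_shift:
  assumes q: "\<And>k. q k permutes {1..n k}"
    and \<sigma>: "\<And>m. ((\<lambda>k. dens k {i. c k (q k i) m \<noteq> c k i (\<sigma> m)}) \<longlongrightarrow> 0) \<omega>"
  shows "distr law seq_space (\<lambda>s. s \<circ> \<sigma>) = law"
proof (rule measure_eqI_PiM_infinite)
  interpret I: finite_measure I01 by (rule finite_I01)
  show "finite_measure (distr law seq_space (\<lambda>s. s \<circ> \<sigma>))"
    unfolding law_def by (subst distr_distr) (auto intro: I.finite_measure_distr)
  fix A :: "nat \<Rightarrow> bool set" and J :: "nat set"
  assume J: "finite J"
  define T where "T s \<longleftrightarrow> (\<forall>j\<in>J. s j \<in> A j)" for s
  have emb: "prod_emb UNIV (\<lambda>_. count_space UNIV) J (Pi\<^sub>E J A) = {s. T s}"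
    by (auto simp: prod_emb_def T_def space_PiM PiE_UNIV_domain restrict_PiE_iff)
  have [measurable]: "Measurable.pred seq_space T"
    unfolding T_def by measurable (use J in auto)
  then have [measurable]: "{s. T s} \<in> sets seq_space"
    by (simp add: pred_def space_PiM PiE_UNIV_domain)
  have law: "emeasure law {s. T' s} = emeasure I01 {t \<in> {0..1}. T' (digits t)}"
    if [measurable]: "Measurable.pred seq_space T'" for T'
    unfolding law_def
    using that
    by (subst emeasure_distr) (auto simp: space_restrict_space space_PiM pred_def PiE_UNIV_domain
        intro!: arg_cong[where f="emeasure I01"])
  \<comment> \<open>This depth decides both \<open>T\<close> and its shifted version, so
    \<open>tendsto_law\<close> applies to each.\<close>
  obtain m where m: "J \<union> \<sigma> ` J \<subseteq> {..<m}"
    using J finite_nat_iff_bounded by (metis finite_UnI finite_imageI)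
  have cong: "T s \<longleftrightarrow> T s'" "T (s \<circ> \<sigma>) \<longleftrightarrow> T (s' \<circ> \<sigma>)"
    if "\<And>j. j < m \<Longrightarrow> s j = s' j" for s s'
    unfolding T_def using that m by (intro ball_cong; simp add: image_subset_iff subset_iff)+
  have lim: "((\<lambda>k. dens k {i. T (c k i)}) \<longlongrightarrow> measure I01 {t\<in>{0..1}. T (digits t)}) \<omega>"
    using cong(1) by (rule tendsto_law)
  have lim': "((\<lambda>k. dens k {i. T (c k i \<circ> \<sigma>)}) \<longlongrightarrow> measure I01 {t\<in>{0..1}. T (digits t \<circ> \<sigma>)}) \<omega>"
    using cong(2) by (rule tendsto_law)
  \<comment> \<open>Off \<open>B k\<close> the two conditions agree; the error
    \<open>dens k (B k)\<close> enters both inequalities below and vanishes in the limit.\<close>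
  define B where "B k = (\<Union>j\<in>J. {i. c k (q k i) j \<noteq> c k i (\<sigma> j)})" for k
  have B: "((\<lambda>k. dens k (B k)) \<longlongrightarrow> 0) \<omega>"
    unfolding B_def using J \<sigma> by (rule dens_UN_tendsto_0)
  have eq: "T (c k (q k i)) \<longleftrightarrow> T (c k i \<circ> \<sigma>)" if "i \<notin> B k" for i k
    using that by (auto simp: B_def T_def)
  have dens: "dens k {i. T (c k i)} = dens k {i. T (c k (q k i))}" for k
    using dens_permute(1)[OF q[of k], of "{i. T (c k i)}"] by (simp add: vimage_def)
  have "dens k {i. T (c k i)} \<le> dens k {i. T (c k i \<circ> \<sigma>)} + dens k (B k)" for k
    unfolding dens by (rule order_trans[OF dens_mono dens_Un_le]) (use eq in auto)
  then have 1: "measure I01 {t\<in>{0..1}. T (digits t)} \<le> measure I01 {t\<in>{0..1}. T (digits t \<circ> \<sigma>)} + 0"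
    by (intro tendsto_le[OF not_bot tendsto_add[OF lim' B] lim]) simp
  have "dens k {i. T (c k i \<circ> \<sigma>)} \<le> dens k {i. T (c k i)} + dens k (B k)" for k
    unfolding dens by (rule order_trans[OF dens_mono dens_Un_le]) (use eq in auto)
  then have 2: "measure I01 {t\<in>{0..1}. T (digits t \<circ> \<sigma>)} \<le> measure I01 {t\<in>{0..1}. T (digits t)} + 0"
    by (intro tendsto_le[OF not_bot tendsto_add[OF lim B] lim']) simp
  have "emeasure (distr law seq_space (\<lambda>s. s \<circ> \<sigma>)) {s. T s} = emeasure law {s. T (s \<circ> \<sigma>)}"
    by (subst emeasure_distr) (auto simp: law_def space_PiM intro!: arg_cong2[where f=emeasure])
  also have "\<dots> = emeasure law {s. T s}"
    using 1 2 by (simp add: law I.emeasure_eq_measure)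
  finally show "emeasure (distr law seq_space (\<lambda>s. s \<circ> \<sigma>)) (prod_emb UNIV (\<lambda>_. count_space UNIV) J (Pi\<^sub>E J A))
      = emeasure law (prod_emb UNIV (\<lambda>_. count_space UNIV) J (Pi\<^sub>E J A))"
    by (simp only: emb)
qed (simp_all add: law_def)

lemma law_shift_inverse:
  assumes inv: "distr law seq_space (\<lambda>s. s \<circ> \<sigma>) = law" and "\<sigma> \<circ> \<tau> = id"
  shows "distr law seq_space (\<lambda>s. s \<circ> \<tau>) = law"
proof -
  have [measurable_cong, simp]: "sets law = sets seq_space"
    by (simp add: law_def)
  have eq: "(\<lambda>s :: nat \<Rightarrow> bool. s \<circ> \<tau>) \<circ> (\<lambda>s. s \<circ> \<sigma>) = (\<lambda>s. s)"
    by (simp add: fun_eq_iff comp_assoc assms(2))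
  have "distr law seq_space (\<lambda>s. s \<circ> \<tau>) = distr (distr law seq_space (\<lambda>s. s \<circ> \<sigma>)) seq_space (\<lambda>s. s \<circ> \<tau>)"
    by (simp add: inv)
  also have "\<dots> = distr law seq_space (\<lambda>s. s)"
    by (subst distr_distr, measurable) (simp only: eq)
  also have "\<dots> = law"
    by (rule distr_id2) simp
  finally show ?thesis .
qed

lemma distr_law_dec: "distr law borel dec = distr I01 borel (\<lambda>t. t)"
  unfolding law_def
  by (subst distr_distr; (rule distr_cong_AE)?)
    (use AE_dec_digits in \<open>auto intro: measurable_restrict_space1\<close>)

lemma measurable_act [measurable]: "act \<sigma> \<in> borel_measurable borel"
  unfolding act_def by measurable

text \<open>Push Lebesgue measure forward in three stages: \<open>digits\<close> gives
  \<open>law\<close>, the shift preserves it, and \<open>dec\<close> returns Lebesgue measure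
  because it undoes \<open>digits\<close> almost everywhere.\<close>

lemma measure_preserving_act:
  assumes inv: "distr law seq_space (\<lambda>s. s \<circ> \<sigma>) = law"
  shows "measure_preserving (lebesgue_on {0..1}) (act \<sigma>)"
proof (rule measure_preserving_lebesgue_on)
  fix B :: "real set" assume B: "B \<in> sets borel"
  have [measurable]: "act \<sigma> \<in> borel_measurable I01" "(\<lambda>t. t) \<in> borel_measurable I01"
    by (auto intro!: measurable_restrict_space1)
  have "distr I01 borel (act \<sigma>) = distr (distr law seq_space (\<lambda>s. s \<circ> \<sigma>)) borel dec"
    unfolding law_def
    by (subst distr_distr, simp, simp)+ (simp add: comp_def act_def[abs_def])
  also have "\<dots> = distr I01 borel (\<lambda>t. t)"
    by (simp add: inv distr_law_dec)
  finally have "emeasure (distr I01 borel (act \<sigma>)) B = emeasure (distr I01 borel (\<lambda>t. t)) B"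
    by simp
  then have "emeasure I01 (act \<sigma> -` B \<inter> {0..1}) = emeasure I01 (B \<inter> {0..1})"
    using B by (simp add: emeasure_distr space_restrict_space)
  then show "emeasure lborel (act \<sigma> -` B \<inter> {0..1}) = emeasure lborel (B \<inter> {0..1})"
    by (simp add: emeasure_restrict_space)
qed (auto simp: act_def dec_bounds simp del: atLeastAtMost_iff)

text \<open>Almost every \<open>s\<close> for \<open>law\<close> is \<open>digits t\<close> with
  \<open>dec (digits t) = t\<close>. Checking the equality bit by bit supplies the measurability
  required for transfer along \<open>distr\<close>.\<close>

lemma AE_digits_dec: "AE s in law. digits (dec s) = s"
proof -
  have "Measurable.pred seq_space (\<lambda>s. \<forall>m. digits (dec s) m = s m)"
    by measurable
  then have "{s \<in> space seq_space. digits (dec s) = s} \<in> sets seq_space"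
    by (simp add: fun_eq_iff pred_def)
  then show ?thesis
    unfolding law_def
    by (subst AE_distr_iff) (use AE_dec_digits in \<open>auto elim!: eventually_mono\<close>)
qed

text \<open>The identity \<open>digits (dec s) = s\<close> is only almost sure and is needed at the
  shifted sequence \<open>s \<circ> \<sigma>\<close>. Invariance of \<open>law\<close> ensures that
  the shift does not concentrate on the exceptional set.\<close>

lemma act_inverse:
  assumes inv: "distr law seq_space (\<lambda>s. s \<circ> \<sigma>) = law" and id: "\<sigma> \<circ> \<tau> = id"
  shows "AE t in lebesgue_on {0..1}. act \<tau> (act \<sigma> t) = t"
proof -
  have [measurable_cong, simp]: "sets law = sets seq_space"
    by (simp add: law_def)
  have "AE s in distr law seq_space (\<lambda>s. s \<circ> \<sigma>). digits (dec s) = s"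
    unfolding inv by (rule AE_digits_dec)
  then have "AE s in law. digits (dec (s \<circ> \<sigma>)) = s \<circ> \<sigma>"
    by (rule AE_distrD[rotated]) simp
  then have "AE t in I01. digits (dec (digits t \<circ> \<sigma>)) = digits t \<circ> \<sigma>"
    unfolding law_def by (rule AE_distrD[rotated]) simp
  then have "AE t in I01. act \<tau> (act \<sigma> t) = t"
    using AE_dec_digits
  proof eventually_elim
    case (elim t)
    then show ?case
      by (simp add: act_def comp_assoc id)
  qed
  then have "AE t in lborel. t \<in> {0..1} \<longrightarrow> act \<tau> (act \<sigma> t) = t"
    by (subst (asm) AE_restrict_space_iff) auto
  then show ?thesis
    by (subst AE_restrict_space_iff) (auto dest: AE_completion)
qed

lemma measure_automorphism_act:
  assumes inv: "distr law seq_space (\<lambda>s. s \<circ> \<sigma>) = law" and "bij \<sigma>"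
  shows "measure_automorphism (lebesgue_on {0..1}) (act \<sigma>)"
proof -
  have id: "\<sigma> \<circ> inv' \<sigma> = id" "inv' \<sigma> \<circ> \<sigma> = id"
    using \<open>bij \<sigma>\<close> by (simp_all add: bij_is_inj bij_is_surj[THEN surj_iff[THEN iffD1]])
  note inv' = law_shift_inverse[OF inv id(1)]
  show ?thesis
    unfolding measure_automorphism_def
    by (intro conjI exI[of _ "act (inv' \<sigma>)"] measure_preserving_act act_inverse inv inv' id)
qed

text \<open>Write a point as the class of \<open>p z\<close>. Its image has standard part
  \<open>pos\<close> of \<open>q z\<close>, hence \<open>dec\<close> of the bits of
  \<open>q z\<close>; these are the bits of \<open>z\<close> reindexed by \<open>\<sigma>\<close>,
  and the bits of \<open>z\<close> are the digits of the original standard part. One null set is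
  discarded for each bit and one for each endpoint.\<close>

lemma AE_standard_part_action:
  assumes q: "\<And>k. q k permutes {1..n k}"
    and \<sigma>: "\<And>m. ((\<lambda>k. dens k {i. c k (q k i) m \<noteq> c k i (\<sigma> m)}) \<longlongrightarrow> 0) \<omega>"
  shows "AE x in loeb_measure \<omega> n.
    standard_part \<omega> n (loeb_action \<omega> n (\<lambda>k. p k \<circ> q k \<circ> inv' (p k)) x) = act \<sigma> (standard_part \<omega> n x)"
proof -
  define B where "B m k = {i. c k (q k i) m \<noteq> c k i (\<sigma> m)}" for m k
  have inv_in: "(\<lambda>k. inv' (p k) (y k)) \<in> loeb_seqs n" if "y \<in> loeb_seqs n" for y
    using that permutes_in_image[OF permutes_inv[OF p_permutes]] by (simp add: loeb_seqs_iff)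
  \<comment> \<open>Quantifying over all representatives \<open>y\<close> turns a condition on
    sequences into a predicate on classes.\<close>
  have "AE x in loeb_measure \<omega> n. \<forall>y\<in>loeb_seqs n. x = loeb_class \<omega> n y \<longrightarrow>
      (\<forall>\<^sub>F k in \<omega>. inv' (p k) (y k) \<notin> B m k)" for m
  proof (rule AE_loeb_small)
    show "((\<lambda>k. dens k (p k ` B m k)) \<longlongrightarrow> 0) \<omega>"
      unfolding dens_permute(2)[OF p_permutes] B_def by (rule \<sigma>)
    fix x assume x: "x \<in> loeb_seqs n" "\<forall>\<^sub>F k in \<omega>. x k \<notin> p k ` B m k"
    show "\<forall>y\<in>loeb_seqs n. loeb_class \<omega> n x = loeb_class \<omega> n y \<longrightarrow>
      (\<forall>\<^sub>F k in \<omega>. inv' (p k) (y k) \<notin> B m k)"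
    proof (intro ballI impI)
      fix y assume "y \<in> loeb_seqs n" "loeb_class \<omega> n x = loeb_class \<omega> n y"
      then have "\<forall>\<^sub>F k in \<omega>. x k = y k"
        using x(1) by (simp add: loeb_class_eq_iff)
      with x(2) show "\<forall>\<^sub>F k in \<omega>. inv' (p k) (y k) \<notin> B m k"
        by eventually_elim (metis imageI p_permutes permutes_inverses(1))
    qed
  qed
  then have "AE x in loeb_measure \<omega> n. \<forall>m. \<forall>y\<in>loeb_seqs n. x = loeb_class \<omega> n y \<longrightarrow>
      (\<forall>\<^sub>F k in \<omega>. inv' (p k) (y k) \<notin> B m k)"
    by (intro AE_all_countable[THEN iffD2] allI)
  moreover have "AE x in loeb_measure \<omega> n. \<forall>l\<in>levels. standard_part \<omega> n x \<noteq> l"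
    by (intro AE_ball_countable[THEN iffD2] ballI countable_levels AE_standard_part_neq)
  moreover have "AE x in loeb_measure \<omega> n. x \<in> loeb_space \<omega> n"
    using AE_space[of "loeb_measure \<omega> n"] by (simp add: space_loeb_measure)
  ultimately show ?thesis
  proof eventually_elim
    case (elim x)
    then obtain y where y: "y \<in> loeb_seqs n" "x = loeb_class \<omega> n y"
      by (auto simp: loeb_space_conv)
    define z where "z = (\<lambda>k. inv' (p k) (y k))"
    have z: "z \<in> loeb_seqs n" and p_z: "p k (z k) = y k" for k
      using inv_in[OF y(1)] permutes_inverses(1)[OF p_permutes] by (simp_all add: z_def)
    have q_z: "(\<lambda>k. q k (z k)) \<in> loeb_seqs n"
      using z permutes_in_image[OF q] by (simp add: loeb_seqs_iff)
    have x: "standard_part \<omega> n x = pos z"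
      by (simp add: y standard_part_loeb_class pos_def p_z)
    have "(p k \<circ> q k \<circ> inv' (p k)) permutes {1..n k}" for k
      using p_permutes q permutes_compose permutes_inv by metis
    then have "loeb_action \<omega> n (\<lambda>k. p k \<circ> q k \<circ> inv' (p k)) x = loeb_class \<omega> n (\<lambda>k. p k (q k (z k)))"
      by (simp add: y loeb_action_loeb_class z_def)
    moreover have "(\<lambda>k. p k (q k (z k))) \<in> loeb_seqs n"
      using q_z permutes_in_image[OF p_permutes] by (simp add: loeb_seqs_iff)
    ultimately have "standard_part \<omega> n (loeb_action \<omega> n (\<lambda>k. p k \<circ> q k \<circ> inv' (p k)) x) =
        pos (\<lambda>k. q k (z k))"
      by (simp add: standard_part_loeb_class pos_def)
    also have "\<dots> = dec (enc (\<lambda>k. q k (z k)))"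
      by (rule dec_enc[OF q_z, symmetric])
    also have "enc (\<lambda>k. q k (z k)) = enc z \<circ> \<sigma>"
    proof
      fix m
      have "\<forall>\<^sub>F k in \<omega>. z k \<notin> B m k"
        using elim y by (simp add: z_def)
      then have "\<forall>\<^sub>F k in \<omega>. c k (q k (z k)) m = c k (z k) (\<sigma> m)"
        by eventually_elim (simp add: B_def)
      then show "enc (\<lambda>k. q k (z k)) m = (enc z \<circ> \<sigma>) m"
        unfolding enc_def comp_apply by (rule eventually_subst)
    qed
    also have "enc z = digits (pos z)"
      using elim z by (intro digits_pos[symmetric]) (auto simp: x)
    finally show ?case
      by (simp only: act_def x)
  qed
qed

end

section \<open>The universal sofic group\<close>

text \<open>List the points in order of increasing \<open>w\<close>. The map from rank to point is a
  permutation, and its inverse gives each point its rank.\<close>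

lemma exists_sorting_permutation:
  fixes w :: "nat \<Rightarrow> nat"
  obtains p where "p permutes {1..N}"
    "\<And>i i'. i \<in> {1..N} \<Longrightarrow> i' \<in> {1..N} \<Longrightarrow> p i \<le> p i' \<Longrightarrow> w i \<le> w i'"
proof -
  define xs where "xs = sort_key w [1..<Suc N]"
  \<comment> \<open>Ranks start at 1 and list positions at 0, hence the shift; outside
    \<open>{1..N}\<close> the map must be the identity to be a permutation of that set.\<close>
  define q where "q j = (if j \<in> {1..N} then xs ! (j - 1) else j)" for j
  have xs: "distinct xs" "set xs = {1..N}" "length xs = N" "sorted (map w xs)"
    by (auto simp: xs_def simp del: upt_Suc)
  have "bij_betw (\<lambda>j. j - 1) {1..N} {..<N}"
    by (rule bij_betw_byWitness[of _ Suc]) auto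
  moreover have "bij_betw ((!) xs) {..<N} {1..N}"
    by (rule bij_betw_nth) (use xs in auto)
  ultimately have "bij_betw ((!) xs \<circ> (\<lambda>j. j - 1)) {1..N} {1..N}"
    by (rule bij_betw_trans)
  moreover have "bij_betw q {1..N} {1..N} \<longleftrightarrow> bij_betw ((!) xs \<circ> (\<lambda>j. j - 1)) {1..N} {1..N}"
    by (rule bij_betw_cong) (simp add: q_def)
  ultimately have q: "q permutes {1..N}"
    by (intro bij_imp_permutes) (auto simp: q_def)
  show thesis
  proof
    show p: "inv' q permutes {1..N}"
      by (rule permutes_inv[OF q])
    fix i i' assume i: "i \<in> {1..N}" "i' \<in> {1..N}" "inv' q i \<le> inv' q i'"
    have in_range: "inv' q i \<in> {1..N}" "inv' q i' \<in> {1..N}"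
      using i permutes_in_image[OF p] by blast+
    have "w (xs ! (inv' q i - 1)) \<le> w (xs ! (inv' q i' - 1))"
      using sorted_nth_mono[OF xs(4), of "inv' q i - 1" "inv' q i' - 1"] in_range i(3) xs(3) by auto
    moreover have "xs ! (inv' q j - 1) = j" if "inv' q j \<in> {1..N}" for j
      using that permutes_inverses(1)[OF q, of j] by (simp add: q_def)
    ultimately show "w i \<le> w i'"
      using in_range by simp
  qed
qed

section \<open>The null subgroup, its cosets and their representatives\<close>

context loeb begin

lemma group_sym_product: "group (sym_product n)"
  unfolding sym_product_def by (rule product_group) (rule sym_group_is_group)

lemma carrier_sym_product: "q \<in> carrier (sym_product n) \<longleftrightarrow> (\<forall>k. q k permutes {1..n k})"
  by (auto simp: sym_product_def sym_group_carrier PiE_UNIV_domain)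

lemma mult_sym_product: "x \<otimes>\<^bsub>sym_product n\<^esub> y = (\<lambda>k. x k \<circ> y k)"
  by (simp add: sym_product_def sym_group_mult restrict_UNIV)

lemma one_sym_product: "\<one>\<^bsub>sym_product n\<^esub> = (\<lambda>k. id)"
  by (simp add: sym_product_def sym_group_one restrict_UNIV)

lemma inv_sym_product:
  assumes "x \<in> carrier (sym_product n)"
  shows "inv\<^bsub>sym_product n\<^esub> x = (\<lambda>k. inv' (x k))"
proof (rule group.inv_equality[OF group_sym_product _ assms])
  have "inv' (x k) \<circ> x k = id" for k
    using assms permutes_inv_o(2) unfolding carrier_sym_product by blast
  then show "(\<lambda>k. inv' (x k)) \<otimes>\<^bsub>sym_product n\<^esub> x = \<one>\<^bsub>sym_product n\<^esub>"
    by (simp add: mult_sym_product one_sym_product)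
  show "(\<lambda>k. inv' (x k)) \<in> carrier (sym_product n)"
    using assms by (simp add: carrier_sym_product permutes_inv)
qed

lemma hamming_null_iff:
  "q \<in> hamming_null \<omega> n \<longleftrightarrow>
    (\<forall>k. q k permutes {1..n k}) \<and> ((\<lambda>k. dens k {i. q k i \<noteq> i}) \<longlongrightarrow> 0) \<omega>"
proof -
  have "{i. q k i \<noteq> i} \<inter> {1..n k} = {i \<in> {1..n k}. q k i \<noteq> i}" for k
    by auto
  then show ?thesis
    by (simp add: hamming_null_def carrier_sym_product hamming_length_def dens_def)
qed

lemma dens_tendsto_0_mono:
  assumes "((\<lambda>k. dens k (S k)) \<longlongrightarrow> 0) \<omega>" "\<And>k. T k \<subseteq> S k"
  shows "((\<lambda>k. dens k (T k)) \<longlongrightarrow> 0) \<omega>"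
  by (rule tendsto_sandwich[OF _ _ tendsto_const assms(1)])
    (use assms(2) dens_bounds in \<open>auto intro!: always_eventually dens_mono\<close>)

lemma normal_hamming_null: "hamming_null \<omega> n \<lhd> sym_product n"
proof -
  interpret S: group "sym_product n" by (rule group_sym_product)
  show ?thesis
    unfolding S.normal_inv_iff
  proof (intro conjI ballI S.subgroupI)
    show "hamming_null \<omega> n \<subseteq> carrier (sym_product n)"
      by (auto simp: hamming_null_def)
    have "(\<lambda>k. id) \<in> hamming_null \<omega> n"
      by (simp add: hamming_null_iff permutes_id dens_def)
    then show "hamming_null \<omega> n \<noteq> {}" by blast
  next
    fix x assume x: "x \<in> hamming_null \<omega> n"
    then have "{i. inv' (x k) i \<noteq> i} = {i. x k i \<noteq> i}" for k
      by (auto simp: hamming_null_iff) (metis permutes_inverses)+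
    with x show "inv\<^bsub>sym_product n\<^esub> x \<in> hamming_null \<omega> n"
      by (simp add: hamming_null_iff inv_sym_product carrier_sym_product permutes_inv)
  next
    fix x y assume xy: "x \<in> hamming_null \<omega> n" "y \<in> hamming_null \<omega> n"
    \<comment> \<open>The union over the Booleans is the union of the points moved by
      \<open>x\<close> and those moved by \<open>y\<close>; a point fixed by both is fixed by the
      product.\<close>
    have "((\<lambda>k. dens k (\<Union>b\<in>UNIV. {i. (if b then x else y) k i \<noteq> i})) \<longlongrightarrow> 0) \<omega>"
      by (rule dens_UN_tendsto_0) (use xy in \<open>auto simp: hamming_null_iff\<close>)
    then have "((\<lambda>k. dens k {i. x k (y k i) \<noteq> i}) \<longlongrightarrow> 0) \<omega>"
      by (rule dens_tendsto_0_mono) (auto simp: UNIV_bool)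
    with xy show "x \<otimes>\<^bsub>sym_product n\<^esub> y \<in> hamming_null \<omega> n"
      by (simp add: hamming_null_iff mult_sym_product permutes_compose)
  next
    fix x h assume x: "x \<in> carrier (sym_product n)" and h: "h \<in> hamming_null \<omega> n"
    have "{i. x k (h k (inv' (x k) i)) \<noteq> i} = x k ` {i. h k i \<noteq> i}" for k
    proof -
      have xk: "x k permutes {1..n k}"
        using x by (simp add: carrier_sym_product)
      have "x k (h k (inv' (x k) i)) \<noteq> i \<longleftrightarrow> h k (inv' (x k) i) \<noteq> inv' (x k) i" for i
        by (metis permutes_inverses[OF xk])
      then have "{i. x k (h k (inv' (x k) i)) \<noteq> i} = inv' (x k) -` {i. h k i \<noteq> i}"
        by auto
      also have "\<dots> = x k ` {i. h k i \<noteq> i}"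
        using bij_vimage_eq_inv_image[OF permutes_bij[OF permutes_inv[OF xk]]]
        by (simp only: permutes_inv_inv[OF xk])
      finally show ?thesis .
    qed
    with x h show "x \<otimes>\<^bsub>sym_product n\<^esub> h \<otimes>\<^bsub>sym_product n\<^esub> inv\<^bsub>sym_product n\<^esub> x \<in> hamming_null \<omega> n"
      by (simp add: hamming_null_iff mult_sym_product inv_sym_product carrier_sym_product
          permutes_compose permutes_inv dens_permute(2))
  qed
qed

sublocale Sym: normal "hamming_null \<omega> n" "sym_product n"
  by (rule normal_hamming_null)

lemma carrier_universal_sofic:
  "X \<in> carrier (universal_sofic \<omega> n) \<longleftrightarrow>
    (\<exists>x\<in>carrier (sym_product n). X = hamming_null \<omega> n #>\<^bsub>sym_product n\<^esub> x)"
  by (auto simp: universal_sofic_def carrier_FactGroup)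

lemma coset_eq:
  assumes "X \<in> carrier (universal_sofic \<omega> n)" "x \<in> X"
  shows "x \<in> carrier (sym_product n)" "X = hamming_null \<omega> n #>\<^bsub>sym_product n\<^esub> x"
proof -
  obtain y where y: "y \<in> carrier (sym_product n)" "X = hamming_null \<omega> n #>\<^bsub>sym_product n\<^esub> y"
    using assms(1) by (auto simp: carrier_universal_sofic)
  then show "x \<in> carrier (sym_product n)"
    using assms(2) Sym.r_coset_subset_G[OF Sym.subset] by blast
  show "X = hamming_null \<omega> n #>\<^bsub>sym_product n\<^esub> x"
    using assms(2) unfolding y(2) by (rule Sym.repr_independence[OF _ y(1) Sym.subgroup_axioms])
qed

lemma group_universal_sofic: "group (universal_sofic \<omega> n)"
  unfolding universal_sofic_def by (rule Sym.factorgroup_is_group)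

lemma mult_universal_sofic_mem:
  assumes "X \<in> carrier (universal_sofic \<omega> n)" "Y \<in> carrier (universal_sofic \<omega> n)" "x \<in> X" "y \<in> Y"
  shows "(\<lambda>k. x k \<circ> y k) \<in> X \<otimes>\<^bsub>universal_sofic \<omega> n\<^esub> Y"
  using assms(3,4) by (auto simp: universal_sofic_def set_mult_def simp flip: mult_sym_product)

lemma inv_universal_sofic_mem:
  assumes "X \<in> carrier (universal_sofic \<omega> n)" "x \<in> X"
  shows "(\<lambda>k. inv' (x k)) \<in> inv\<^bsub>universal_sofic \<omega> n\<^esub> X"
  using assms coset_eq(1)[OF assms] Sym.inv_FactGroup[of X]
  by (auto simp: universal_sofic_def SET_INV_def simp flip: inv_sym_product)

text \<open>Two representatives differ by a left factor \<open>h\<close> in the null subgroup. They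
  disagree at \<open>i\<close> exactly when \<open>h\<close> moves \<open>y k i\<close>, and pulling
  back along a permutation preserves density.\<close>

lemma coset_dens:
  assumes "X \<in> carrier (universal_sofic \<omega> n)" "x \<in> X" "y \<in> X"
  shows "((\<lambda>k. dens k {i. x k i \<noteq> y k i}) \<longlongrightarrow> 0) \<omega>"
proof -
  have y: "y k permutes {1..n k}" for k
    using coset_eq(1)[OF assms(1,3)] by (simp add: carrier_sym_product)
  have "x \<in> hamming_null \<omega> n #>\<^bsub>sym_product n\<^esub> y"
    using coset_eq(2)[OF assms(1,3)] assms(2) by simp
  then obtain h where h: "h \<in> hamming_null \<omega> n" "x = (\<lambda>k. h k \<circ> y k)"
    by (auto simp: r_coset_def mult_sym_product)
  have "{i. x k i \<noteq> y k i} = y k -` {i. h k i \<noteq> i}" for k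
    by (auto simp: h(2))
  then show ?thesis
    using h(1) by (simp only: dens_permute(1)[OF y] hamming_null_iff)
qed

text \<open>Undoing the conjugation pointwise turns \<open>q\<close> into a member of
  \<open>X\<close>. Thus every representative of the conjugate class is literally a conjugate by the
  fixed sequence \<open>p\<close>, as needed since \<open>restricts_to\<close> speaks of all
  representatives.\<close>

lemma conjugate_mem:
  assumes P: "P \<in> carrier (universal_sofic \<omega> n)" "p \<in> P" and X: "X \<in> carrier (universal_sofic \<omega> n)"
    and q: "q \<in> P \<otimes>\<^bsub>universal_sofic \<omega> n\<^esub> X \<otimes>\<^bsub>universal_sofic \<omega> n\<^esub> inv\<^bsub>universal_sofic \<omega> n\<^esub> P"
  obtains r where "r \<in> X" "q = (\<lambda>k. p k \<circ> r k \<circ> inv' (p k))"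
proof
  interpret U: group "universal_sofic \<omega> n" by (rule group_universal_sofic)
  let ?Y = "P \<otimes>\<^bsub>universal_sofic \<omega> n\<^esub> X \<otimes>\<^bsub>universal_sofic \<omega> n\<^esub> inv\<^bsub>universal_sofic \<omega> n\<^esub> P"
  have p: "p k permutes {1..n k}" for k
    using coset_eq(1)[OF P] by (simp add: carrier_sym_product)
  have "inv\<^bsub>universal_sofic \<omega> n\<^esub> P \<otimes>\<^bsub>universal_sofic \<omega> n\<^esub> ?Y \<otimes>\<^bsub>universal_sofic \<omega> n\<^esub> P = X"
    using P X by (simp add: U.m_assoc U.inv_solve_left')
  moreover have "(\<lambda>k. inv' (p k) \<circ> q k \<circ> p k) \<in>
      inv\<^bsub>universal_sofic \<omega> n\<^esub> P \<otimes>\<^bsub>universal_sofic \<omega> n\<^esub> ?Y \<otimes>\<^bsub>universal_sofic \<omega> n\<^esub> P"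
    by (intro mult_universal_sofic_mem inv_universal_sofic_mem U.m_closed U.inv_closed P X q)
  ultimately show "(\<lambda>k. inv' (p k) \<circ> q k \<circ> p k) \<in> X"
    by simp
  show "q = (\<lambda>k. p k \<circ> (inv' (p k) \<circ> q k \<circ> p k) \<circ> inv' (p k))"
    using permutes_inverses(1)[OF p] by (simp add: fun_eq_iff)
qed

text \<open>Points of \<open>J\<close> are on the same side of every grid value
  \<open>a * n k / b\<close>, so their images under \<open>r\<close> lie within
  \<open>n k / b\<close> of each other. The permutation \<open>r\<close> occurs because the chosen
  representative of the neutral element may differ from the identity.\<close>

lemma card_grid_cell:
  fixes b :: nat
  assumes b: "0 < b" and r: "r permutes {1..n k}"
    and J: "\<And>i i' a. i \<in> J \<Longrightarrow> i' \<in> J \<Longrightarrow> a \<le> b \<Longrightarrow> r i * b \<le> a * n k \<Longrightarrow> r i' * b \<le> a * n k"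
  shows "dens k J \<le> 2 / b + 1 / n k"
proof (cases "J \<inter> {1..n k} = {}")
  case True
  then show ?thesis by (simp add: dens_def)
next
  case False
  then obtain i\<^sub>0 where i\<^sub>0: "i\<^sub>0 \<in> J" "i\<^sub>0 \<in> {1..n k}" by blast
  have lt: "r i' * b < r i * b + n k" if i: "i \<in> J" "i \<in> {1..n k}" "i' \<in> J" for i i'
  proof -
    \<comment> \<open>This is the ceiling of \<open>r i * b / n k\<close>, the least grid index not
      below \<open>r i\<close>. The summand \<open>n k - 1\<close> performs the rounding up.\<close>
    define a where "a = (r i * b + (n k - 1)) div n k"
    define d where "d = (r i * b + (n k - 1)) mod n k"
    have eq: "r i * b + (n k - 1) = a * n k + d"
      unfolding a_def d_def by (rule div_mult_mod_eq[symmetric])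
    have d: "d < n k"
      using n_pos by (simp add: d_def)
    have "r i \<le> n k"
      using i(2) permutes_in_image[OF r, of i] by auto
    then have "r i * b \<le> b * n k"
      by (simp add: mult.commute)
    then have "a * n k < (b + 1) * n k"
      using eq n_pos[of k] unfolding add_mult_distrib by linarith
    then have "a \<le> b"
      by (metis Suc_eq_plus1 less_Suc_eq_le mult_less_cancel2)
    moreover have "r i * b \<le> a * n k"
      using eq d by linarith
    ultimately have "r i' * b \<le> a * n k"
      using J i by blast
    then show ?thesis
      using eq n_pos[of k] by linarith
  qed
  have "r ` (J \<inter> {1..n k}) \<subseteq> {j. \<bar>real j - r i\<^sub>0\<bar> \<le> n k / b}"
  proof clarify
    fix i assume i: "i \<in> J" "i \<in> {1..n k}"
    have "real (r i) * b < r i\<^sub>0 * b + n k" "real (r i\<^sub>0) * b < r i * b + n k"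
      using lt[OF i\<^sub>0 i(1)] lt[OF i i\<^sub>0(1)] by (simp_all flip: of_nat_mult of_nat_add)
    then show "\<bar>real (r i) - r i\<^sub>0\<bar> \<le> n k / b"
      using b by (simp add: abs_le_iff field_simps)
  qed
  then have "card (r ` (J \<inter> {1..n k})) \<le> card {j. \<bar>real j - r i\<^sub>0\<bar> \<le> n k / b}"
    by (rule card_mono[OF card_near(1), rotated]) simp
  moreover have "card (r ` (J \<inter> {1..n k})) = card (J \<inter> {1..n k})"
    using permutes_inj_on[OF r] by (rule card_image)
  ultimately have "real (card (J \<inter> {1..n k})) \<le> 2 * (n k / b) + 1"
    using card_near(2)[of "n k / b" "real (r i\<^sub>0)"] by simp
  then have "dens k J \<le> (2 * (n k / b) + 1) / n k"
    unfolding dens_def by (rule divide_right_mono) simp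
  also have "\<dots> = 2 / b + 1 / n k"
    using n_pos[of k] by (simp add: field_simps)
  finally show ?thesis .
qed

end

section \<open>Bits obtained from the sofic representation, and the conjugating element\<close>

theorem theorem3p3:
  fixes \<omega> :: "nat filter" and n :: "nat \<Rightarrow> nat"
    and G :: "('g, 'b) monoid_scheme"
    and \<theta> :: "'g \<Rightarrow> (nat \<Rightarrow> nat \<Rightarrow> nat) set"
  assumes "nonprincipal_ultrafilter \<omega>"
    and "strict_mono n" and "\<forall>k. 0 < n k"
    and "group G" and "countable (carrier G)"
    and "sofic_representation \<omega> n G \<theta>"
  shows "\<exists>p \<in> carrier (universal_sofic \<omega> n). \<forall>g \<in> carrier G.
    p \<otimes>\<^bsub>universal_sofic \<omega> n\<^esub> \<theta> g \<otimes>\<^bsub>universal_sofic \<omega> n\<^esub> inv\<^bsub>universal_sofic \<omega> n\<^esub> p \<in> GA \<omega> n"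
proof -
  interpret G: group G by fact
  interpret loeb \<omega> n
    using assms by unfold_locales auto
  interpret U: group "universal_sofic \<omega> n" by (rule group_universal_sofic)
  have \<theta>: "\<theta> \<in> hom G (universal_sofic \<omega> n)"
    using assms(6) by (simp add: sofic_representation_def)
  have \<theta>_carrier: "\<theta> g \<in> carrier (universal_sofic \<omega> n)" if "g \<in> carrier G" for g
    using hom_in_carrier[OF \<theta> that] .
  have "\<exists>r. r \<in> \<theta> g" if "g \<in> carrier G" for g
    using \<theta>_carrier[OF that] Sym.rcos_self[OF _ Sym.subgroup_axioms]
    unfolding carrier_universal_sofic by blast
  then obtain r where r: "\<And>g. g \<in> carrier G \<Longrightarrow> r g \<in> \<theta> g"
    by metis
  have rep_permutes: "q k permutes {1..n k}" if "g \<in> carrier G" "q \<in> \<theta> g" for g q k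
    using coset_eq(1)[OF \<theta>_carrier that(2)] that(1) by (simp add: carrier_sym_product)
  \<comment> \<open>One bit for each group element \<open>h\<close> and each grid fraction
    \<open>a / b\<close>. The index set is countably infinite, so \<open>ix\<close> and
    \<open>el\<close> are mutually inverse bijections with the naturals.\<close>
  define S where "S = carrier G \<times> (UNIV :: (nat \<times> nat) set)"
  have S: "countable S" "infinite S"
    using assms(5) by (auto simp: S_def finite_cartesian_product_iff finite_prod)
  define ix where "ix = to_nat_on S"
  define el where "el = from_nat_into S"
  have el_ix: "el (ix s) = s" if "s \<in> S" for s
    using S that by (simp add: el_def ix_def)
  have el_in: "el m \<in> S" for m
    using S by (auto simp: el_def intro: from_nat_into)
  \<comment> \<open>The bit records whether the position of \<open>\<theta>(h)\<close> applied to
    \<open>i\<close>, divided by \<open>n k\<close>, is at most \<open>a / b\<close>; multiplying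
    out avoids division.\<close>
  define c where "c k i m = (case el m of (h, a, b) \<Rightarrow> r h k i * b \<le> a * n k)" for k i m
  have "\<exists>p. p permutes {1..n k} \<and> (\<forall>i\<in>{1..n k}. \<forall>i'\<in>{1..n k}. p i \<le> p i' \<longrightarrow>
      prefix (c k i) k \<le> prefix (c k i') k)" for k
    by (rule exists_sorting_permutation[of "n k" "\<lambda>i. prefix (c k i) k"]) blast
  then obtain p where p: "\<And>k. p k permutes {1..n k}"
    and p_mono: "\<And>k i i'. i \<in> {1..n k} \<Longrightarrow> i' \<in> {1..n k} \<Longrightarrow> p k i \<le> p k i' \<Longrightarrow>
      prefix (c k i) k \<le> prefix (c k i') k"
    by metis
  interpret coding \<omega> n c p
  proof
    fix e :: real assume e: "0 < e"
    obtain b :: nat where b: "4 / e < b"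
      using reals_Archimedean2 by blast
    then have b0: "0 < b"
      using e by (metis divide_pos_pos less_trans of_nat_0_less_iff zero_less_numeral)
    have be: "2 / b \<le> e / 2"
      using b b0 e by (simp add: field_simps)
    \<comment> \<open>The bits of the neutral element with denominator \<open>b\<close> alone
      already make cylinders small; this depth includes all of them, and \<open>4 / e < b\<close>
      gives \<open>2 / b \<le> e / 2\<close>.\<close>
    obtain m where m: "(\<lambda>a. ix (\<one>\<^bsub>G\<^esub>, a, b)) ` {..b} \<subseteq> {..<m}"
      using finite_nat_iff_bounded by (metis finite_atMost finite_imageI)
    have c_ix: "c k i (ix (\<one>\<^bsub>G\<^esub>, a, b)) \<longleftrightarrow> r \<one>\<^bsub>G\<^esub> k i * b \<le> a * n k" for k i a
      by (simp add: c_def el_ix S_def)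
    have "\<forall>\<^sub>F k in \<omega>. 1 / real (n k) < e / 2"
      using one_div_n e by (intro order_tendstoD) auto
    then have "\<forall>\<^sub>F k in \<omega>. dens k {i. prefix (c k i) m = x} \<le> e" for x
    proof eventually_elim
      case (elim k)
      have "dens k {i. prefix (c k i) m = x} \<le> 2 / b + 1 / n k"
      proof (rule card_grid_cell[OF b0 rep_permutes[OF G.one_closed r[OF G.one_closed]]])
        fix i i' a
        assume "i \<in> {i. prefix (c k i) m = x}" "i' \<in> {i. prefix (c k i) m = x}"
          and a: "a \<le> b" "r \<one>\<^bsub>G\<^esub> k i * b \<le> a * n k"
        then have "\<forall>j<m. c k i j = c k i' j"
          by (simp flip: prefix_eq_iff)
        moreover have "ix (\<one>\<^bsub>G\<^esub>, a, b) < m"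
          using m a(1) by auto
        ultimately show "r \<one>\<^bsub>G\<^esub> k i' * b \<le> a * n k"
          using a(2) c_ix by blast
      qed
      with elim be show ?case by linarith
    qed
    then show "\<exists>m. \<forall>x. \<forall>\<^sub>F k in \<omega>. dens k {i. prefix (c k i) m = x} \<le> e"
      by blast
  qed (use p p_mono in auto)
  define P where "P = hamming_null \<omega> n #>\<^bsub>sym_product n\<^esub> p"
  have P: "P \<in> carrier (universal_sofic \<omega> n)" "p \<in> P"
    using p Sym.rcos_self[OF _ Sym.subgroup_axioms, of p] by (auto simp: P_def carrier_universal_sofic carrier_sym_product)
  have "P \<otimes>\<^bsub>universal_sofic \<omega> n\<^esub> \<theta> g \<otimes>\<^bsub>universal_sofic \<omega> n\<^esub> inv\<^bsub>universal_sofic \<omega> n\<^esub> P \<in> GA \<omega> n"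
    if g: "g \<in> carrier G" for g
  proof -
    \<comment> \<open>Right translation appears because evaluating bit \<open>(h, a, b)\<close>
      after \<open>\<theta>(g)\<close> tests
      \<open>\<theta>(h) \<theta>(g) = \<theta>(h g)\<close>.\<close>
    define tr where "tr = (\<lambda>(h, ab). (h \<otimes>\<^bsub>G\<^esub> g, ab :: nat \<times> nat))"
    define \<sigma> where "\<sigma> = ix \<circ> (tr \<circ> el)"
    have tr_in: "tr s \<in> S" if "s \<in> S" for s
      using that g by (auto simp: tr_def S_def)
    have tr_bij: "bij_betw tr S S"
      by (rule bij_betw_byWitness[of _ "\<lambda>(h, ab). (h \<otimes>\<^bsub>G\<^esub> inv\<^bsub>G\<^esub> g, ab)"])
        (use g in \<open>auto simp: tr_def S_def G.m_assoc\<close>)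
    have "bij \<sigma>"
      unfolding \<sigma>_def ix_def el_def
      by (rule bij_betw_trans[OF bij_betw_trans[OF bij_betw_from_nat_into[OF S] tr_bij] to_nat_on_infinite[OF S]])
    have close: "((\<lambda>k. dens k {i. c k (q k i) m \<noteq> c k i (\<sigma> m)}) \<longlongrightarrow> 0) \<omega>" if q: "q \<in> \<theta> g" for q m
    proof -
      obtain h a b where m: "el m = (h, a, b)" and h: "h \<in> carrier G"
        using el_in[of m] by (auto simp: S_def)
      have \<sigma>m: "el (\<sigma> m) = (h \<otimes>\<^bsub>G\<^esub> g, a, b)"
        using el_ix[OF tr_in[OF el_in[of m]]] by (simp add: \<sigma>_def m tr_def)
      have hg: "h \<otimes>\<^bsub>G\<^esub> g \<in> carrier G"
        using g h by simp
      \<comment> \<open>Both this product and the chosen \<open>r\<close> represent the same class,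
        so the bits they define disagree only on a set of vanishing density.\<close>
      have "(\<lambda>k. r h k \<circ> q k) \<in> \<theta> (h \<otimes>\<^bsub>G\<^esub> g)"
        unfolding hom_mult[OF \<theta> h g]
        by (intro mult_universal_sofic_mem \<theta>_carrier h g r q)
      from coset_dens[OF \<theta>_carrier[OF hg] this r[OF hg]] show ?thesis
        by (rule dens_tendsto_0_mono) (auto simp: c_def m \<sigma>m)
    qed
    have "restricts_to \<omega> n
      (P \<otimes>\<^bsub>universal_sofic \<omega> n\<^esub> \<theta> g \<otimes>\<^bsub>universal_sofic \<omega> n\<^esub> inv\<^bsub>universal_sofic \<omega> n\<^esub> P) (act \<sigma>)"
      unfolding restricts_to_def
    proof (intro conjI ballI)
      show "act \<sigma> \<in> {0..1} \<rightarrow> {0..1}"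
        using dec_bounds by (simp add: act_def)
      fix q assume "q \<in> P \<otimes>\<^bsub>universal_sofic \<omega> n\<^esub> \<theta> g \<otimes>\<^bsub>universal_sofic \<omega> n\<^esub> inv\<^bsub>universal_sofic \<omega> n\<^esub> P"
      then obtain q' where q': "q' \<in> \<theta> g" "q = (\<lambda>k. p k \<circ> q' k \<circ> inv' (p k))"
        by (rule conjugate_mem[OF P \<theta>_carrier[OF g]])
      show "AE x in loeb_measure \<omega> n.
          standard_part \<omega> n (loeb_action \<omega> n q x) = act \<sigma> (standard_part \<omega> n x)"
        unfolding q'(2)
        by (rule AE_standard_part_action[OF rep_permutes[OF g q'(1)] close[OF q'(1)]])
    qed
    moreover have "measure_automorphism (lebesgue_on {0..1}) (act \<sigma>)"
      by (rule measure_automorphism_act[OF law_shift[OF rep_permutes[OF g r[OF g]] close[OF r[OF g]]] \<open>bij \<sigma>\<close>])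
    moreover have "P \<otimes>\<^bsub>universal_sofic \<omega> n\<^esub> \<theta> g \<otimes>\<^bsub>universal_sofic \<omega> n\<^esub> inv\<^bsub>universal_sofic \<omega> n\<^esub> P
        \<in> carrier (universal_sofic \<omega> n)"
      using P(1) \<theta>_carrier[OF g] by simp
    ultimately show ?thesis
      unfolding GA_def by blast
  qed
  with P(1) show ?thesis by blast
qed

end
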